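(* Deductions in $\mathbf{INF}^J$ can be brought into normal form: for every deduction in $\mathbf{INF}^J$ with conclusion $A$ and open assumptions $\Gamma$ there is a deduction in $\mathbf{INF}^J$ of $A$, all of whose open assumptions belong to $\Gamma$, which is in normal form.
   Context: **Language.** First-order language with parameters $a,b,\ldots$ (used as free variables, distinct in shape from the bound variables $x,y,z,\ldots$), constants, predicate letters, identity $=$, and $\bot,\land,\lor,\rightarrow,\exists,\forall$ (no existence predicate); $\neg A$ is $A\rightarrow\bot$. Terms are parameters and constants. $A_t^x$ is $A$ with $t$ replacing all free occurrences of $x$. Prime (here also: atomic) formulas are those formed by a predicate letter or $=$ from terms; $\bot$ is not prime. **Rules of $\mathbf{INF}^J$** (a Jaśkowski-style formulation of intuitionist negative free logic in which nodes of deductions, including assumptions, may be terms as well as formulas; natural deduction trees, $[\,\cdot\,]$ marks a class of assumptions discharged by the rule, vacuous discharge allowed). $(\land I)$: from $A$, $B$ infer $A\land B$. $(\land E)$: from $A\land B$ infer $A$; from $A\land B$ infer $B$. $(\rightarrow I)$: from a deduction of $B$ from $[A]$ infer $A\rightarrow B$. $(\rightarrow E)$: from $A\rightarrow B$ and $A$ infer $B$. $(\lor I)$: from $A$ infer $A\lor B$; from $B$ infer $A\lor B$. $(\lor E)$: from $A\lor B$, a deduction of $C$ from $[A]$ and a deduction of $C$ from $[B]$ infer $C$. $(\bot E)$: from $\bot$ infer a formula $B$. $(\forall I^J)$: from a deduction $\Pi$ of $A_a^x$ from $[a]$ infer $\forall xA$, where $a$ does not occur in $\forall xA$ nor in undischarged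 assumptions of $\Pi$ except those in the class of $a$. $(\forall E^J)$: from $\forall xA$ and $t$ infer $A_t^x$. $(\exists I^J)$: from $A_t^x$ and $t$ infer $\exists xA$. $(\exists E^J)$: from $\exists xA$ and a deduction $\Pi$ of $C$ from $[A_a^x],[a]$ infer $C$, where $a$ does not occur in $C$, in $\exists xA$, nor in undischarged assumptions of $\Pi$ except those in the classes of $A_a^x$ and $a$. In $(\lor E)$ and $(\exists E^J)$, $C$ may be a formula or a term. $(=I^{nJ})$: from $t$ infer $t=t$. $(=E)$: from $t_1=t_2$ and $A_{t_1}^x$ infer $A_{t_2}^x$. $(AD^J)$: from $Rt_1\ldots t_n$ infer $t_i$ ($1\le i\le n$), where $R$ is a predicate letter or $=$. **Standing conventions.** Applications of $(=E)$ have atomic conclusions and applications of $(\bot E)$ have prime conclusions. Vacuous applications of $(=E)$ (major premise $t=t$) are assumed to be always removed. The major premise of an elimination rule is its leftmost premise in the list above, the other premises are minor. **Segments and normal form.** A *segment* is a sequence of occurrences $C_1,\ldots,C_n$ of the same formula (or term) such that $C_1$ is not the conclusion of $(\lor E)$ or $(\exists E^J)$, $C_n$ is not a minor premise of $(\lor E)$ or $(\exists E^J)$, and for all $i<n$, $C_i$ is a minor premise of $(\lor E)$ or $(\exists E^J)$ with conclusion $C_{i+1}$; $n$ is its length. A segment is said to be a premise (conclusion) of a rule if its last (first) element is. The following segments are maximal. (1) A segment whose last formula is the major premise of an elimination rule and which, if its length is $1$, is the conclusion of an introduction rule. (2) A segment of formulas $t=t$ whose first formula is concluded by $(=I^{nJ})$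 and whose last is the premise of $(AD^J)$. (3) A segment of occurrences of a term $t$ whose first element is concluded from $t=t$ by $(AD^J)$ and whose last is the premise of $(=I^{nJ})$. (4) An $(=E)$-segment whose last segment is the premise of $(AD^J)$, where an $(=E)$-segment is a sequence of segments $\sigma_1,\ldots,\sigma_n$ such that $\sigma_1$ is the minor premise but not the conclusion of $(=E)$, $\sigma_n$ is the conclusion but not the minor premise of $(=E)$, each $\sigma_i$ with $1<i<n$ is both, and $\sigma_{i+1}$ is concluded from minor premise $\sigma_i$. A deduction is in *normal form* if it contains no maximal segments of any of these kinds. *)

theory Defs
  imports Main
begin

section \<open>Language\<close>

text \<open>
  Parameters and bound variables are two disjoint sorts of symbols. Terms are parameters and
  constants only; a bound variable may merely fill an argument place of a predicate letter or
  of identity. A letter \<open>R\<close> applied to \<open>n\<close> arguments is an \<open>n\<close>-place predicate letter,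
  so letters with different numbers of arguments count as different.
\<close>

datatype 'c tm = Par nat | Cst 'c

datatype 'c arg = Var nat | Tm "'c tm"

datatype ('c, 'p) fm =
    Pred 'p "'c arg list"
  | Eq "'c arg" "'c arg"
  | Bot
  | And "('c, 'p) fm" "('c, 'p) fm"
  | Or "('c, 'p) fm" "('c, 'p) fm"
  | Imp "('c, 'p) fm" "('c, 'p) fm"
  | Exi nat "('c, 'p) fm"
  | Uni nat "('c, 'p) fm"

text \<open>\<open>subst x t A\<close> is $A_t^x$. Terms contain no bound variables, so nothing can be captured.\<close>

primrec subst_arg :: "nat \<Rightarrow> 'c tm \<Rightarrow> 'c arg \<Rightarrow> 'c arg" where
  "subst_arg x t (Var y) = (if y = x then Tm t else Var y)"
| "subst_arg x t (Tm s) = Tm s"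

primrec subst :: "nat \<Rightarrow> 'c tm \<Rightarrow> ('c, 'p) fm \<Rightarrow> ('c, 'p) fm" where
  "subst x t (Pred R us) = Pred R (map (subst_arg x t) us)"
| "subst x t (Eq u v) = Eq (subst_arg x t u) (subst_arg x t v)"
| "subst x t Bot = Bot"
| "subst x t (And A B) = And (subst x t A) (subst x t B)"
| "subst x t (Or A B) = Or (subst x t A) (subst x t B)"
| "subst x t (Imp A B) = Imp (subst x t A) (subst x t B)"
| "subst x t (Exi y A) = Exi y (if y = x then A else subst x t A)"
| "subst x t (Uni y A) = Uni y (if y = x then A else subst x t A)"

primrec vars_arg :: "'c arg \<Rightarrow> nat set" where
  "vars_arg (Var x) = {x}"
| "vars_arg (Tm t) = {}"

primrec free_vars :: "('c, 'p) fm \<Rightarrow> nat set" where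
  "free_vars (Pred R us) = (\<Union>u\<in>set us. vars_arg u)"
| "free_vars (Eq u v) = vars_arg u \<union> vars_arg v"
| "free_vars Bot = {}"
| "free_vars (And A B) = free_vars A \<union> free_vars B"
| "free_vars (Or A B) = free_vars A \<union> free_vars B"
| "free_vars (Imp A B) = free_vars A \<union> free_vars B"
| "free_vars (Exi x A) = free_vars A - {x}"
| "free_vars (Uni x A) = free_vars A - {x}"

text \<open>
  The role of free variables is played by parameters: a formula proper has no unbound
  occurrence of a bound variable.
\<close>

definition closed_fm :: "('c, 'p) fm \<Rightarrow> bool" where
  "closed_fm A \<longleftrightarrow> free_vars A = {}"

primrec prime_fm :: "('c, 'p) fm \<Rightarrow> bool" where
  "prime_fm (Pred R us) \<longleftrightarrow> True"
| "prime_fm (Eq u v) \<longleftrightarrow> True"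
| "prime_fm Bot \<longleftrightarrow> False"
| "prime_fm (And A B) \<longleftrightarrow> False"
| "prime_fm (Or A B) \<longleftrightarrow> False"
| "prime_fm (Imp A B) \<longleftrightarrow> False"
| "prime_fm (Exi x A) \<longleftrightarrow> False"
| "prime_fm (Uni x A) \<longleftrightarrow> False"

primrec params_tm :: "'c tm \<Rightarrow> nat set" where
  "params_tm (Par a) = {a}"
| "params_tm (Cst c) = {}"

primrec params_arg :: "'c arg \<Rightarrow> nat set" where
  "params_arg (Var x) = {}"
| "params_arg (Tm t) = params_tm t"

primrec params_fm :: "('c, 'p) fm \<Rightarrow> nat set" where
  "params_fm (Pred R us) = (\<Union>u\<in>set us. params_arg u)"
| "params_fm (Eq u v) = params_arg u \<union> params_arg v"
| "params_fm Bot = {}"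
| "params_fm (And A B) = params_fm A \<union> params_fm B"
| "params_fm (Or A B) = params_fm A \<union> params_fm B"
| "params_fm (Imp A B) = params_fm A \<union> params_fm B"
| "params_fm (Exi x A) = params_fm A"
| "params_fm (Uni x A) = params_fm A"


section \<open>Deductions\<close>

datatype ('c, 'p) node = Fml "('c, 'p) fm" | Trm "'c tm"

primrec closed_node :: "('c, 'p) node \<Rightarrow> bool" where
  "closed_node (Fml A) \<longleftrightarrow> closed_fm A"
| "closed_node (Trm t) \<longleftrightarrow> True"

primrec params_node :: "('c, 'p) node \<Rightarrow> nat set" where
  "params_node (Fml A) = params_fm A"
| "params_node (Trm t) = params_tm t"

text \<open>
  A deduction is a tree of rule applications; the premises are listed from left to right, so
  that the premise with index \<open>0\<close> is the major premise of an elimination rule. Assumptions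
  carry a label, and an assumption class consists of the assumptions with a given label and
  a given formula or term. The rules that discharge assumptions record the discharged classes
  (\<open>ExE u B v a\<close> those of \<open>B\<close> labelled \<open>u\<close> and of the parameter \<open>a\<close> labelled \<open>v\<close>);
  a discharged class may be empty.
\<close>

datatype ('c, 'p) inf_rule =
    Asm nat
  | AndI | AndE
  | ImpI nat "('c, 'p) fm" | ImpE
  | OrI | OrE nat "('c, 'p) fm" nat "('c, 'p) fm"
  | BotE
  | UniI nat nat | UniE
  | ExI | ExE nat "('c, 'p) fm" nat nat
  | EqI | EqE
  | AD

datatype ('c, 'p) ded =
  Inf (rule_of: "('c, 'p) inf_rule") (concl: "('c, 'p) node") (prems: "('c, 'p) ded list")

text \<open>The classes that an application of a rule discharges above its \<open>i\<close>-th premise.\<close>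

fun discharged :: "('c, 'p) inf_rule \<Rightarrow> nat \<Rightarrow> (nat \<times> ('c, 'p) node) set" where
  "discharged (ImpI u A) i = {(u, Fml A)}"
| "discharged (OrE u A v B) i =
     (if i = 1 then {(u, Fml A)} else if i = 2 then {(v, Fml B)} else {})"
| "discharged (UniI u a) i = {(u, Trm (Par a))}"
| "discharged (ExE u B v a) i = (if i = 1 then {(u, Fml B), (v, Trm (Par a))} else {})"
| "discharged _ i = {}"

fun assumed :: "('c, 'p) inf_rule \<Rightarrow> ('c, 'p) node \<Rightarrow> (nat \<times> ('c, 'p) node) set" where
  "assumed (Asm u) C = {(u, C)}"
| "assumed _ C = {}"

primrec open_classes :: "('c, 'p) ded \<Rightarrow> (nat \<times> ('c, 'p) node) set" where
  "open_classes (Inf r C Ds) =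
     assumed r C \<union> (\<Union>i<length Ds. (map open_classes Ds ! i) - discharged r i)"

definition open_assumptions :: "('c, 'p) ded \<Rightarrow> ('c, 'p) node set" where
  "open_assumptions D = snd ` open_classes D"

text \<open>
  Closedness is required exactly where a rule brings in a formula that is not determined by
  its premises. The conventions on \<open>EqE\<close> (prime conclusion, not vacuous) and \<open>BotE\<close>
  (prime conclusion) are side conditions of these rules.
\<close>

inductive deduction :: "('c, 'p) ded \<Rightarrow> bool" where
  asm: "closed_node C \<Longrightarrow> deduction (Inf (Asm u) C [])"
| and_I: "deduction D1 \<Longrightarrow> deduction D2 \<Longrightarrow> concl D1 = Fml A \<Longrightarrow> concl D2 = Fml B \<Longrightarrow>
    deduction (Inf AndI (Fml (And A B)) [D1, D2])"
| and_E1: "deduction D \<Longrightarrow> concl D = Fml (And A B) \<Longrightarrow> deduction (Inf AndE (Fml A) [D])"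
| and_E2: "deduction D \<Longrightarrow> concl D = Fml (And A B) \<Longrightarrow> deduction (Inf AndE (Fml B) [D])"
| imp_I: "deduction D \<Longrightarrow> concl D = Fml B \<Longrightarrow> closed_fm A \<Longrightarrow>
    deduction (Inf (ImpI u A) (Fml (Imp A B)) [D])"
| imp_E: "deduction D1 \<Longrightarrow> deduction D2 \<Longrightarrow> concl D1 = Fml (Imp A B) \<Longrightarrow> concl D2 = Fml A \<Longrightarrow>
    deduction (Inf ImpE (Fml B) [D1, D2])"
| or_I1: "deduction D \<Longrightarrow> concl D = Fml A \<Longrightarrow> closed_fm B \<Longrightarrow>
    deduction (Inf OrI (Fml (Or A B)) [D])"
| or_I2: "deduction D \<Longrightarrow> concl D = Fml B \<Longrightarrow> closed_fm A \<Longrightarrow>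
    deduction (Inf OrI (Fml (Or A B)) [D])"
| or_E: "deduction D \<Longrightarrow> deduction D1 \<Longrightarrow> deduction D2 \<Longrightarrow>
    concl D = Fml (Or A B) \<Longrightarrow> concl D1 = C \<Longrightarrow> concl D2 = C \<Longrightarrow>
    deduction (Inf (OrE u A v B) C [D, D1, D2])"
| bot_E: "deduction D \<Longrightarrow> concl D = Fml Bot \<Longrightarrow> closed_fm B \<Longrightarrow> prime_fm B \<Longrightarrow>
    deduction (Inf BotE (Fml B) [D])"
| uni_I: "deduction D \<Longrightarrow> concl D = Fml (subst x (Par a) A) \<Longrightarrow>
    a \<notin> params_fm (Uni x A) \<Longrightarrow>
    \<forall>(w, C) \<in> open_classes D - {(u, Trm (Par a))}. a \<notin> params_node C \<Longrightarrow>
    deduction (Inf (UniI u a) (Fml (Uni x A)) [D])"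
| uni_E: "deduction D1 \<Longrightarrow> deduction D2 \<Longrightarrow> concl D1 = Fml (Uni x A) \<Longrightarrow> concl D2 = Trm t \<Longrightarrow>
    deduction (Inf UniE (Fml (subst x t A)) [D1, D2])"
| ex_I: "deduction D1 \<Longrightarrow> deduction D2 \<Longrightarrow> concl D1 = Fml (subst x t A) \<Longrightarrow> concl D2 = Trm t \<Longrightarrow>
    deduction (Inf ExI (Fml (Exi x A)) [D1, D2])"
| ex_E: "deduction D1 \<Longrightarrow> deduction D2 \<Longrightarrow> concl D1 = Fml (Exi x A) \<Longrightarrow> concl D2 = C \<Longrightarrow>
    B = subst x (Par a) A \<Longrightarrow>
    a \<notin> params_node C \<Longrightarrow> a \<notin> params_fm (Exi x A) \<Longrightarrow>
    \<forall>(w, C') \<in> open_classes D2 - {(u, Fml B), (v, Trm (Par a))}. a \<notin> params_node C' \<Longrightarrow>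
    deduction (Inf (ExE u B v a) C [D1, D2])"
| eq_I: "deduction D \<Longrightarrow> concl D = Trm t \<Longrightarrow> deduction (Inf EqI (Fml (Eq (Tm t) (Tm t))) [D])"
| eq_E: "deduction D1 \<Longrightarrow> deduction D2 \<Longrightarrow> concl D1 = Fml (Eq (Tm t1) (Tm t2)) \<Longrightarrow>
    concl D2 = Fml (subst x t1 A) \<Longrightarrow> prime_fm A \<Longrightarrow> t1 \<noteq> t2 \<Longrightarrow>
    deduction (Inf EqE (Fml (subst x t2 A)) [D1, D2])"
| AD_Pred: "deduction D \<Longrightarrow> concl D = Fml (Pred R us) \<Longrightarrow> Tm t \<in> set us \<Longrightarrow>
    deduction (Inf AD (Trm t) [D])"
| AD_Eq: "deduction D \<Longrightarrow> concl D = Fml (Eq (Tm t1) (Tm t2)) \<Longrightarrow> t = t1 \<or> t = t2 \<Longrightarrow>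
    deduction (Inf AD (Trm t) [D])"


section \<open>Segments and normal form\<close>

text \<open>
  An occurrence in a deduction is addressed by the path leading to it from the root; the
  occurrence \<open>q @ [i]\<close> is the \<open>i\<close>-th premise of the rule application concluding \<open>q\<close>.
\<close>

primrec occurs :: "('c, 'p) ded \<Rightarrow> nat list \<Rightarrow> bool" where
  "occurs D [] \<longleftrightarrow> True"
| "occurs D (i # p) \<longleftrightarrow> i < length (prems D) \<and> occurs (prems D ! i) p"

primrec subded :: "('c, 'p) ded \<Rightarrow> nat list \<Rightarrow> ('c, 'p) ded" where
  "subded D [] = D"
| "subded D (i # p) = subded (prems D ! i) p"

abbreviation node_at :: "('c, 'p) ded \<Rightarrow> nat list \<Rightarrow> ('c, 'p) node" where
  "node_at D p \<equiv> concl (subded D p)"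

abbreviation rule_at :: "('c, 'p) ded \<Rightarrow> nat list \<Rightarrow> ('c, 'p) inf_rule" where
  "rule_at D p \<equiv> rule_of (subded D p)"

fun is_intro :: "('c, 'p) inf_rule \<Rightarrow> bool" where
  "is_intro AndI = True"
| "is_intro (ImpI u A) = True"
| "is_intro OrI = True"
| "is_intro (UniI u a) = True"
| "is_intro ExI = True"
| "is_intro EqI = True"
| "is_intro _ = False"

fun is_elim :: "('c, 'p) inf_rule \<Rightarrow> bool" where
  "is_elim AndE = True"
| "is_elim ImpE = True"
| "is_elim (OrE u A v B) = True"
| "is_elim BotE = True"
| "is_elim UniE = True"
| "is_elim (ExE u B v a) = True"
| "is_elim EqE = True"
| "is_elim _ = False"

fun is_OrE_ExE :: "('c, 'p) inf_rule \<Rightarrow> bool" where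
  "is_OrE_ExE (OrE u A v B) = True"
| "is_OrE_ExE (ExE u B v a) = True"
| "is_OrE_ExE _ = False"

definition premise_of :: "(('c, 'p) inf_rule \<Rightarrow> bool) \<Rightarrow> ('c, 'p) ded \<Rightarrow> nat list \<Rightarrow> bool" where
  "premise_of P D p \<longleftrightarrow> (\<exists>q i. p = q @ [i] \<and> P (rule_at D q))"

definition major_premise_of ::
    "(('c, 'p) inf_rule \<Rightarrow> bool) \<Rightarrow> ('c, 'p) ded \<Rightarrow> nat list \<Rightarrow> bool" where
  "major_premise_of P D p \<longleftrightarrow> (\<exists>q. p = q @ [0] \<and> P (rule_at D q))"

definition minor_premise_of ::
    "(('c, 'p) inf_rule \<Rightarrow> bool) \<Rightarrow> ('c, 'p) ded \<Rightarrow> nat list \<Rightarrow> bool" where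
  "minor_premise_of P D p \<longleftrightarrow> (\<exists>q i. p = q @ [i] \<and> 0 < i \<and> P (rule_at D q))"

text \<open>\<open>segment D C ps\<close>: \<open>ps\<close> is a segment of occurrences of \<open>C\<close> in \<open>D\<close>.\<close>

definition segment :: "('c, 'p) ded \<Rightarrow> ('c, 'p) node \<Rightarrow> nat list list \<Rightarrow> bool" where
  "segment D C ps \<longleftrightarrow>
     ps \<noteq> [] \<and>
     (\<forall>p\<in>set ps. occurs D p \<and> node_at D p = C) \<and>
     \<not> is_OrE_ExE (rule_at D (hd ps)) \<and>
     \<not> minor_premise_of is_OrE_ExE D (last ps) \<and>
     (\<forall>i. Suc i < length ps \<longrightarrow>
        minor_premise_of is_OrE_ExE D (ps ! i) \<and> ps ! Suc i = butlast (ps ! i))"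

definition maximal_elim :: "('c, 'p) ded \<Rightarrow> nat list list \<Rightarrow> bool" where
  "maximal_elim D ps \<longleftrightarrow>
     (\<exists>A. segment D (Fml A) ps) \<and>
     major_premise_of is_elim D (last ps) \<and>
     (length ps = 1 \<longrightarrow> is_intro (rule_at D (hd ps)))"

definition maximal_EqI_AD :: "('c, 'p) ded \<Rightarrow> nat list list \<Rightarrow> bool" where
  "maximal_EqI_AD D ps \<longleftrightarrow>
     (\<exists>t. segment D (Fml (Eq (Tm t) (Tm t))) ps) \<and>
     rule_at D (hd ps) = EqI \<and>
     premise_of (\<lambda>r. r = AD) D (last ps)"

definition maximal_AD_EqI :: "('c, 'p) ded \<Rightarrow> nat list list \<Rightarrow> bool" where
  "maximal_AD_EqI D ps \<longleftrightarrow>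
     (\<exists>t. segment D (Trm t) ps \<and>
          rule_at D (hd ps) = AD \<and> node_at D (hd ps @ [0]) = Fml (Eq (Tm t) (Tm t))) \<and>
     premise_of (\<lambda>r. r = EqI) D (last ps)"

definition concl_of_EqE :: "('c, 'p) ded \<Rightarrow> nat list list \<Rightarrow> bool" where
  "concl_of_EqE D ps \<longleftrightarrow> rule_at D (hd ps) = EqE"

definition minor_of_EqE :: "('c, 'p) ded \<Rightarrow> nat list list \<Rightarrow> bool" where
  "minor_of_EqE D ps \<longleftrightarrow> minor_premise_of (\<lambda>r. r = EqE) D (last ps)"

definition EqE_segment :: "('c, 'p) ded \<Rightarrow> nat list list list \<Rightarrow> bool" where
  "EqE_segment D ss \<longleftrightarrow>
     ss \<noteq> [] \<and>
     (\<forall>ps\<in>set ss. \<exists>A. segment D (Fml A) ps) \<and>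
     minor_of_EqE D (hd ss) \<and> \<not> concl_of_EqE D (hd ss) \<and>
     concl_of_EqE D (last ss) \<and> \<not> minor_of_EqE D (last ss) \<and>
     (\<forall>i. 0 < i \<and> Suc i < length ss \<longrightarrow> minor_of_EqE D (ss ! i) \<and> concl_of_EqE D (ss ! i)) \<and>
     (\<forall>i. Suc i < length ss \<longrightarrow> last (ss ! i) = hd (ss ! Suc i) @ [1])"

definition maximal_EqE_AD :: "('c, 'p) ded \<Rightarrow> nat list list list \<Rightarrow> bool" where
  "maximal_EqE_AD D ss \<longleftrightarrow>
     EqE_segment D ss \<and> premise_of (\<lambda>r. r = AD) D (last (last ss))"

definition normal_form :: "('c, 'p) ded \<Rightarrow> bool" where
  "normal_form D \<longleftrightarrow>
     (\<nexists>ps. maximal_elim D ps) \<and>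
     (\<nexists>ps. maximal_EqI_AD D ps) \<and>
     (\<nexists>ps. maximal_AD_EqI D ps) \<and>
     (\<nexists>ss. maximal_EqE_AD D ss)"

end

theory Submission
  imports Defs
begin

text \<open>
  Normalization by evaluation. Instead of reducing a given deduction, one interprets it in a
  Kripke--Beth model whose worlds are sets of assumptions: a world forces a prime formula or a
  term if it derives it normally, while disjunctions and existential formulas are forced locally,
  on a cover obtained by eliminating neutrally derived formulas. For the rules on identity and
  \<open>AD\<close>, soundness means that they are admissible for normal derivability, which holds because they
  can be permuted upwards. A world forces every formula it derives neutrally and normally
  derives every closed formula it forces, so the conclusion of a deduction is normally
  derivable from its assumptions.
\<close>

section \<open>Parameters and substitution\<close>

text \<open>Reducing deductions directly would call for a measure that decreases both when
  \<open>OrE\<close> and \<open>ExE\<close> are permuted and when \<open>AD\<close>,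
  \<open>EqI\<close> and \<open>EqE\<close> meet across a segment. Forcing replaces such a measure
  by inductions on formulas and on derivations. The kinds of derivation record which rule may stand
  directly below. A prime formula concluded by \<open>EqE\<close> may be the major premise of
  another \<open>EqE\<close>, but not the premise of \<open>AD\<close>; this separates headed from
  neutral. A term obtained by \<open>AD\<close> from \<open>t = t\<close> may serve a quantifier
  rule, but not \<open>EqI\<close>; so it is only normal. A world may mention every parameter, so
  none need be fresh for it. Reification therefore extends a world by an arbitrary parameter, and
  the derivation rules ask for all of them.\<close>

primrec psub_tm :: "(nat \<Rightarrow> 'c tm) \<Rightarrow> 'c tm \<Rightarrow> 'c tm" where
  "psub_tm \<sigma> (Par a) = \<sigma> a"
| "psub_tm \<sigma> (Cst c) = Cst c"

primrec psub_arg :: "(nat \<Rightarrow> 'c tm) \<Rightarrow> 'c arg \<Rightarrow> 'c arg" where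
  "psub_arg \<sigma> (Var x) = Var x"
| "psub_arg \<sigma> (Tm t) = Tm (psub_tm \<sigma> t)"

primrec psub_fm :: "(nat \<Rightarrow> 'c tm) \<Rightarrow> ('c, 'p) fm \<Rightarrow> ('c, 'p) fm" where
  "psub_fm \<sigma> (Pred R us) = Pred R (map (psub_arg \<sigma>) us)"
| "psub_fm \<sigma> (Eq u v) = Eq (psub_arg \<sigma> u) (psub_arg \<sigma> v)"
| "psub_fm \<sigma> Bot = Bot"
| "psub_fm \<sigma> (And A B) = And (psub_fm \<sigma> A) (psub_fm \<sigma> B)"
| "psub_fm \<sigma> (Or A B) = Or (psub_fm \<sigma> A) (psub_fm \<sigma> B)"
| "psub_fm \<sigma> (Imp A B) = Imp (psub_fm \<sigma> A) (psub_fm \<sigma> B)"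
| "psub_fm \<sigma> (Exi x A) = Exi x (psub_fm \<sigma> A)"
| "psub_fm \<sigma> (Uni x A) = Uni x (psub_fm \<sigma> A)"

primrec psub_node :: "(nat \<Rightarrow> 'c tm) \<Rightarrow> ('c, 'p) node \<Rightarrow> ('c, 'p) node" where
  "psub_node \<sigma> (Fml A) = Fml (psub_fm \<sigma> A)"
| "psub_node \<sigma> (Trm t) = Trm (psub_tm \<sigma> t)"

lemma psub_arg_subst_arg:
  "psub_arg \<sigma> (subst_arg x t u) = subst_arg x (psub_tm \<sigma> t) (psub_arg \<sigma> u)"
  by (cases u) auto

lemma psub_fm_subst: "psub_fm \<sigma> (subst x t A) = subst x (psub_tm \<sigma> t) (psub_fm \<sigma> A)"
  by (induction A) (auto simp: psub_arg_subst_arg)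

lemma psub_tm_Par [simp]: "psub_tm Par t = t"
  by (cases t) auto

lemma psub_arg_Par [simp]: "psub_arg Par u = u"
  by (cases u) auto

lemma psub_fm_Par [simp]: "psub_fm Par A = A"
  by (induction A) (auto intro: map_idI)

lemma psub_node_Par [simp]: "psub_node Par C = C"
  by (cases C) auto

lemma psub_tm_upd: "a \<notin> params_tm t \<Longrightarrow> psub_tm (\<sigma>(a := s)) t = psub_tm \<sigma> t"
  by (cases t) auto

lemma psub_arg_upd: "a \<notin> params_arg u \<Longrightarrow> psub_arg (\<sigma>(a := s)) u = psub_arg \<sigma> u"
  by (cases u) (auto simp: psub_tm_upd)

lemma psub_fm_upd: "a \<notin> params_fm A \<Longrightarrow> psub_fm (\<sigma>(a := s)) A = psub_fm \<sigma> A"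
  by (induction A) (auto simp: psub_arg_upd)

lemma psub_node_upd: "a \<notin> params_node C \<Longrightarrow> psub_node (\<sigma>(a := s)) C = psub_node \<sigma> C"
  by (cases C) (auto simp: psub_tm_upd psub_fm_upd)

text \<open>Soundness is proved under an environment \<sigma> sending parameters to terms. An
  eigenparameter is interpreted by changing \<sigma> at one place, which turns the instance at
  \<open>Par a\<close> into the instance at an arbitrary \<open>s\<close>.\<close>

lemma psub_fm_eigen:
  "a \<notin> params_fm A \<Longrightarrow> psub_fm (\<sigma>(a := s)) (subst x (Par a) A) = subst x s (psub_fm \<sigma> A)"
  by (simp add: psub_fm_subst psub_fm_upd)

lemma vars_arg_psub [simp]: "vars_arg (psub_arg \<sigma> u) = vars_arg u"
  by (cases u) auto

lemma free_vars_psub [simp]: "free_vars (psub_fm \<sigma> A) = free_vars A"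
  by (induction A) auto

lemma closed_node_psub [simp]: "closed_node (psub_node \<sigma> C) = closed_node C"
  by (cases C) (auto simp: closed_fm_def)

lemma prime_fm_psub [simp]: "prime_fm (psub_fm \<sigma> A) = prime_fm A"
  by (cases A) auto

lemma prime_fm_subst [simp]: "prime_fm (subst x t A) = prime_fm A"
  by (cases A) auto

lemma vars_arg_subst [simp]: "vars_arg (subst_arg x t u) = vars_arg u - {x}"
  by (cases u) auto

lemma free_vars_subst [simp]: "free_vars (subst x t A) = free_vars A - {x}"
  by (induction A) auto

lemma closed_fm_simps [simp]:
  "closed_fm Bot"
  "closed_fm (And A B) \<longleftrightarrow> closed_fm A \<and> closed_fm B"
  "closed_fm (Or A B) \<longleftrightarrow> closed_fm A \<and> closed_fm B"
  "closed_fm (Imp A B) \<longleftrightarrow> closed_fm A \<and> closed_fm B"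
  "closed_fm (Eq (Tm t) (Tm s))"
  by (auto simp: closed_fm_def)

lemma closed_fm_Uni: "closed_fm (Uni x A) \<longleftrightarrow> closed_fm (subst x t A)"
  and closed_fm_Exi: "closed_fm (Exi x A) \<longleftrightarrow> closed_fm (subst x t A)"
  by (auto simp: closed_fm_def)

lemma closed_fm_subst_iff: "closed_fm (subst x t A) \<longleftrightarrow> closed_fm (subst x s A)"
  by (simp add: closed_fm_def)

lemma finite_params_tm: "finite (params_tm t)"
  by (cases t) auto

lemma finite_params_arg: "finite (params_arg u)"
  by (cases u) (auto simp: finite_params_tm)

lemma finite_params_fm: "finite (params_fm A)"
  by (induction A) (auto simp: finite_params_arg)

lemma finite_params_node: "finite (params_node C)"
  by (cases C) (auto simp: finite_params_fm finite_params_tm)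

lemma exists_fresh_parameter:
  assumes "finite \<Gamma>"
  shows "\<exists>a. \<forall>C\<in>\<Gamma>. a \<notin> params_node C"
proof -
  have "finite (\<Union>C\<in>\<Gamma>. params_node C)"
    using assms by (simp add: finite_params_node)
  then show ?thesis
    using ex_new_if_finite[OF infinite_UNIV_nat] by fastforce
qed

text \<open>These are the terms that \<open>AD\<close> may extract. The empty value on compound
  formulas builds the restriction to prime formulas into membership.\<close>

primrec terms_of :: "('c, 'p) fm \<Rightarrow> 'c tm set" where
  "terms_of (Pred R us) = {t. Tm t \<in> set us}"
| "terms_of (Eq u v) = {t. u = Tm t \<or> v = Tm t}"
| "terms_of Bot = {}"
| "terms_of (And A B) = {}"
| "terms_of (Or A B) = {}"
| "terms_of (Imp A B) = {}"
| "terms_of (Exi x A) = {}"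
| "terms_of (Uni x A) = {}"

lemma subst_arg_eq_Tm: "subst_arg x s u = Tm t \<Longrightarrow> u = Tm t \<or> t = s"
  by (cases u) (auto split: if_splits)

lemma terms_of_substD: "t \<in> terms_of (subst x s A) \<Longrightarrow> t \<in> terms_of A \<or> t = s"
proof (cases A)
  case (Pred R us)
  assume "t \<in> terms_of (subst x s A)"
  then have "Tm t \<in> subst_arg x s ` set us"
    using Pred by simp
  then obtain u where "u \<in> set us" "subst_arg x s u = Tm t"
    by (metis imageE)
  then show ?thesis
    using Pred subst_arg_eq_Tm by fastforce
qed (auto dest: subst_arg_eq_Tm)

lemma terms_of_substI: "t \<in> terms_of A \<Longrightarrow> t \<in> terms_of (subst x s A)"
  by (cases A) (auto simp: image_iff intro: bexI[of _ "Tm t"])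

lemma terms_of_psub: "t \<in> terms_of A \<Longrightarrow> psub_tm \<sigma> t \<in> terms_of (psub_fm \<sigma> A)"
  by (cases A) (auto simp: image_iff intro: bexI[of _ "Tm t"])

primrec connectives :: "('c, 'p) fm \<Rightarrow> nat" where
  "connectives (Pred R us) = 0"
| "connectives (Eq u v) = 0"
| "connectives Bot = 0"
| "connectives (And A B) = Suc (connectives A + connectives B)"
| "connectives (Or A B) = Suc (connectives A + connectives B)"
| "connectives (Imp A B) = Suc (connectives A + connectives B)"
| "connectives (Exi x A) = Suc (connectives A)"
| "connectives (Uni x A) = Suc (connectives A)"

lemma connectives_subst [simp]: "connectives (subst x t A) = connectives A"
  by (induction A) auto

text \<open>The body of a closed quantified formula need not be closed, so the quantifier cases
  speak of its instances. Substitution preserves the number of connectives, on which the induction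
  runs.\<close>

lemma closed_fm_induct [consumes 1, case_names prime Bot And Or Imp Exi Uni]:
  assumes "closed_fm A"
    and "\<And>A. prime_fm A \<Longrightarrow> closed_fm A \<Longrightarrow> P A"
    and "P Bot"
    and "\<And>A B. closed_fm A \<Longrightarrow> closed_fm B \<Longrightarrow> P A \<Longrightarrow> P B \<Longrightarrow> P (And A B)"
    and "\<And>A B. closed_fm A \<Longrightarrow> closed_fm B \<Longrightarrow> P A \<Longrightarrow> P B \<Longrightarrow> P (Or A B)"
    and "\<And>A B. closed_fm A \<Longrightarrow> closed_fm B \<Longrightarrow> P A \<Longrightarrow> P B \<Longrightarrow> P (Imp A B)"
    and "\<And>x A. (\<And>t. closed_fm (subst x t A)) \<Longrightarrow> (\<And>t. P (subst x t A)) \<Longrightarrow> P (Exi x A)"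
    and "\<And>x A. (\<And>t. closed_fm (subst x t A)) \<Longrightarrow> (\<And>t. P (subst x t A)) \<Longrightarrow> P (Uni x A)"
  shows "P A"
  using assms(1)
proof (induction A rule: measure_induct_rule[of connectives])
  case (less A)
  then show ?case
  proof (cases A)
    case (Exi x B)
    then have "closed_fm (subst x t B)" for t
      using less.prems closed_fm_Exi by blast
    then show ?thesis using Exi less.IH assms(7) by simp
  next
    case (Uni x B)
    then have "closed_fm (subst x t B)" for t
      using less.prems closed_fm_Uni by blast
    then show ?thesis using Uni less.IH assms(8) by simp
  qed (use less assms(2-6) in auto)
qed

lemma closed_concl: "deduction D \<Longrightarrow> closed_node (concl D)"
proof (induction rule: deduction.induct)
  case (uni_I D x a A u)
  then show ?case using closed_fm_Uni by fastforce
next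
  case (uni_E D1 D2 x A t)
  then show ?case using closed_fm_Uni by fastforce
next
  case (ex_I D1 D2 x t A)
  then show ?case using closed_fm_Exi by fastforce
next
  case (eq_E D1 D2 t1 t2 x A)
  then show ?case using closed_fm_subst_iff by fastforce
qed auto

section \<open>Normal derivability\<close>

datatype kind = Neutral | Headed | Normal

text \<open>
  A headed derivation does not end with an introduction, \<open>OrE\<close> or \<open>ExE\<close>; in a neutral one
  \<open>EqE\<close> is excluded as well, and so is \<open>AD\<close> with premise $t = t$. Instead of a freshness
  condition, the rules with an eigenvariable have one premise for every parameter. This makes
  weakening provable without renaming, and a fresh parameter is chosen only when a deduction
  tree is built.
\<close>

inductive der :: "kind \<Rightarrow> ('c, 'p) node set \<Rightarrow> ('c, 'p) node \<Rightarrow> bool" where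
  hyp: "C \<in> \<Gamma> \<Longrightarrow> closed_node C \<Longrightarrow> der Neutral \<Gamma> C"
| AndE1: "der Neutral \<Gamma> (Fml (And A B)) \<Longrightarrow> der Neutral \<Gamma> (Fml A)"
| AndE2: "der Neutral \<Gamma> (Fml (And A B)) \<Longrightarrow> der Neutral \<Gamma> (Fml B)"
| ImpE: "der Neutral \<Gamma> (Fml (Imp A B)) \<Longrightarrow> der Normal \<Gamma> (Fml A) \<Longrightarrow> der Neutral \<Gamma> (Fml B)"
| UniE: "der Neutral \<Gamma> (Fml (Uni x A)) \<Longrightarrow> der Normal \<Gamma> (Trm t) \<Longrightarrow>
    der Neutral \<Gamma> (Fml (subst x t A))"
| BotE: "der Neutral \<Gamma> (Fml Bot) \<Longrightarrow> prime_fm A \<Longrightarrow> closed_fm A \<Longrightarrow> der Neutral \<Gamma> (Fml A)"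
| AD: "der Neutral \<Gamma> (Fml A) \<Longrightarrow> closed_fm A \<Longrightarrow> t \<in> terms_of A \<Longrightarrow> A \<noteq> Eq (Tm t) (Tm t) \<Longrightarrow>
    der Neutral \<Gamma> (Trm t)"
| headed: "der Neutral \<Gamma> C \<Longrightarrow> der Headed \<Gamma> C"
| EqE: "der Headed \<Gamma> (Fml (Eq (Tm t1) (Tm t2))) \<Longrightarrow> der Normal \<Gamma> (Fml (subst x t1 A)) \<Longrightarrow>
    prime_fm A \<Longrightarrow> t1 \<noteq> t2 \<Longrightarrow> der Headed \<Gamma> (Fml (subst x t2 A))"
| normal: "der Headed \<Gamma> C \<Longrightarrow> der Normal \<Gamma> C"
| AD_refl: "der Neutral \<Gamma> (Fml (Eq (Tm t) (Tm t))) \<Longrightarrow> der Normal \<Gamma> (Trm t)"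
| EqI: "der Neutral \<Gamma> (Trm t) \<Longrightarrow> der Normal \<Gamma> (Fml (Eq (Tm t) (Tm t)))"
| AndI: "der Normal \<Gamma> (Fml A) \<Longrightarrow> der Normal \<Gamma> (Fml B) \<Longrightarrow> der Normal \<Gamma> (Fml (And A B))"
| ImpI: "der Normal (insert (Fml A) \<Gamma>) (Fml B) \<Longrightarrow> closed_fm A \<Longrightarrow>
    der Normal \<Gamma> (Fml (Imp A B))"
| OrI1: "der Normal \<Gamma> (Fml A) \<Longrightarrow> closed_fm B \<Longrightarrow> der Normal \<Gamma> (Fml (Or A B))"
| OrI2: "der Normal \<Gamma> (Fml B) \<Longrightarrow> closed_fm A \<Longrightarrow> der Normal \<Gamma> (Fml (Or A B))"
| OrE: "der Neutral \<Gamma> (Fml (Or A B)) \<Longrightarrow> der Normal (insert (Fml A) \<Gamma>) C \<Longrightarrow>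
    der Normal (insert (Fml B) \<Gamma>) C \<Longrightarrow> der Normal \<Gamma> C"
| UniI: "(\<And>a. der Normal (insert (Trm (Par a)) \<Gamma>) (Fml (subst x (Par a) A))) \<Longrightarrow>
    der Normal \<Gamma> (Fml (Uni x A))"
| ExI: "der Normal \<Gamma> (Fml (subst x t A)) \<Longrightarrow> der Normal \<Gamma> (Trm t) \<Longrightarrow>
    der Normal \<Gamma> (Fml (Exi x A))"
| ExE: "der Neutral \<Gamma> (Fml (Exi x A)) \<Longrightarrow>
    (\<And>a. der Normal (insert (Fml (subst x (Par a) A)) (insert (Trm (Par a)) \<Gamma>)) C) \<Longrightarrow>
    der Normal \<Gamma> C"

lemma der_weaken: "der k \<Gamma> C \<Longrightarrow> \<Gamma> \<subseteq> \<Gamma>' \<Longrightarrow> der k \<Gamma>' C"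
proof (induction arbitrary: \<Gamma>' rule: der.induct)
  case (ImpE \<Gamma> A B)
  then show ?case by (blast intro: der.ImpE)
next
  case (UniE \<Gamma> x A t)
  then show ?case by (blast intro: der.UniE)
next
  case (AD \<Gamma> A t)
  then show ?case by (blast intro: der.AD)
next
  case (EqE \<Gamma> t1 t2 x A)
  then show ?case by (blast intro: der.EqE)
next
  case (ExI \<Gamma> x t A)
  then show ?case by (blast intro: der.ExI)
next
  case (ImpI A \<Gamma> B)
  then show ?case by (meson der.ImpI insert_mono)
next
  case (OrE \<Gamma> A B C)
  then show ?case by (meson der.OrE insert_mono)
next
  case (UniI \<Gamma> x A)
  then show ?case by (meson der.UniI insert_mono)
next
  case (ExE \<Gamma> x A C)
  then show ?case by (meson der.ExE insert_mono)
qed (auto intro: der.intros)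

section \<open>Admissible rules of normal derivability\<close>

lemma neutral_normal: "der Neutral \<Gamma> C \<Longrightarrow> der Normal \<Gamma> C"
  by (intro der.normal der.headed)

lemma hyp_fml: "Fml A \<in> \<Gamma> \<Longrightarrow> closed_fm A \<Longrightarrow> der Neutral \<Gamma> (Fml A)"
  and hyp_trm: "Trm t \<in> \<Gamma> \<Longrightarrow> der Neutral \<Gamma> (Trm t)"
  by (simp_all add: der.hyp)

lemma hyp_trm_normal: "Trm t \<in> \<Gamma> \<Longrightarrow> der Normal \<Gamma> (Trm t)"
  by (intro neutral_normal hyp_trm)

lemma neutral_AD:
  assumes "der Neutral \<Gamma> (Fml A)" "closed_fm A" "t \<in> terms_of A"
  shows "der Normal \<Gamma> (Trm t)"
  using assms by (cases "A = Eq (Tm t) (Tm t)") (auto intro: der.AD_refl neutral_normal der.AD)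

text \<open>\<open>AD\<close> is pushed above \<open>OrE\<close>, \<open>ExE\<close> and
  \<open>EqE\<close> until its premise is neutral or the conclusion of \<open>EqI\<close>; in the
  latter case the premise of \<open>EqI\<close> already is the required term. The kind is arbitrary
  because the premises of \<open>EqE\<close> are of two different kinds.\<close>

lemma der_AD:
  assumes "der k \<Gamma> C" "C = Fml A" "closed_fm A" "t \<in> terms_of A"
  shows "der Normal \<Gamma> (Trm t)"
  using assms
proof (induction arbitrary: A rule: der.induct)
  case (EqE \<Gamma> t1 t2 x B)
  \<comment> \<open>A term of the conclusion of \<open>EqE\<close> either was already an argument in
    the minor premise or is \<open>t2\<close>, which the major premise supplies.\<close>
  from EqE.prems have "t \<in> terms_of B \<or> t = t2"
    by (auto dest: terms_of_substD)
  then show ?case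
  proof
    assume "t \<in> terms_of B"
    then have "t \<in> terms_of (subst x t1 B)" by (rule terms_of_substI)
    moreover have "closed_fm (subst x t1 B)"
      using EqE.prems by (auto simp: closed_fm_def)
    ultimately show ?thesis using EqE.IH(2) by blast
  next
    assume "t = t2"
    then show ?thesis using EqE.IH(1) by simp
  qed
next
  case (OrE \<Gamma> B1 B2 C)
  show ?case by (rule der.OrE[OF OrE.hyps(1)]) (use OrE in blast)+
next
  case (ExE \<Gamma> x B C)
  show ?case by (rule der.ExE[OF ExE.hyps(1)]) (use ExE in blast)
next
  case (EqI \<Gamma> s)
  then show ?case by (auto intro: neutral_normal)
qed (auto intro: neutral_AD hyp_fml hyp_trm der.AndE1 der.AndE2 der.ImpE der.UniE der.BotE)

text \<open>\<open>EqI\<close> moves up through \<open>OrE\<close> and \<open>ExE\<close> to a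
  neutral term. If the term came from \<open>t = t\<close> by \<open>AD\<close>, the two steps
  cancel and that neutral premise is the result.\<close>

lemma der_EqI:
  assumes "der k \<Gamma> C" "C = Trm t"
  shows "der Normal \<Gamma> (Fml (Eq (Tm t) (Tm t)))"
  using assms
proof (induction rule: der.induct)
  case (OrE \<Gamma> B1 B2 C)
  show ?case by (rule der.OrE[OF OrE.hyps(1)]) (use OrE in blast)+
next
  case (ExE \<Gamma> x B C)
  show ?case by (rule der.ExE[OF ExE.hyps(1)]) (use ExE in blast)
next
  case (AD \<Gamma> A s)
  then show ?case by (blast intro: der.EqI der.AD)
next
  case (AD_refl \<Gamma> s)
  then show ?case by (auto intro: neutral_normal)
qed (auto intro: der.EqI hyp_fml hyp_trm)

text \<open>\<open>EqE\<close> is permuted into the minor premises of the \<open>OrE\<close> and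
  \<open>ExE\<close> that end the derivation of its major premise, while its own minor premise is
  weakened to the added assumptions. A major premise obtained by \<open>EqI\<close> would make both
  terms equal, and then nothing is to be inferred.\<close>

lemma der_EqE:
  assumes "der k \<Gamma> C" "C = Fml (Eq (Tm t1) (Tm t2))"
    and "der Normal \<Gamma> (Fml (subst x t1 A))" "prime_fm A"
  shows "der Normal \<Gamma> (Fml (subst x t2 A))"
proof (cases "t1 = t2")
  case False
  have headed: "der Normal \<Delta> (Fml (subst x t2 A))"
    if "der Headed \<Delta> (Fml (Eq (Tm t1) (Tm t2)))" "der Normal \<Delta> (Fml (subst x t1 A))" for \<Delta>
    by (rule der.normal[OF der.EqE[OF that assms(4) False]])
  \<comment> \<open>The guard leaves only rules with a normal conclusion to the induction; the local
    fact \<open>headed\<close> settles the other kinds afterwards.\<close>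
  have "k = Normal \<longrightarrow> der Normal \<Gamma> (Fml (subst x t2 A))"
    using assms(1-3)
  proof (induction rule: der.induct)
    case (normal \<Gamma> C)
    then show ?case using headed by simp
  next
    case (EqI \<Gamma> t)
    then show ?case using False by auto
  next
    case (OrE \<Gamma> B1 B2 C)
    have "der Normal (insert (Fml B1) \<Gamma>) (Fml (subst x t2 A))"
      using OrE.IH(2) OrE.prems der_weaken[OF OrE.prems(2) subset_insertI] by simp
    moreover have "der Normal (insert (Fml B2) \<Gamma>) (Fml (subst x t2 A))"
      using OrE.IH(3) OrE.prems der_weaken[OF OrE.prems(2) subset_insertI] by simp
    ultimately show ?case using der.OrE[OF OrE.hyps(1)] by simp
  next
    case (ExE \<Gamma> y B C)
    have "der Normal (insert (Fml (subst y (Par a) B)) (insert (Trm (Par a)) \<Gamma>)) (Fml (subst x t2 A))"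
      for a
    proof -
      have "\<Gamma> \<subseteq> insert (Fml (subst y (Par a) B)) (insert (Trm (Par a)) \<Gamma>)" by blast
      then show ?thesis using ExE.IH(2)[of a] ExE.prems der_weaken[OF ExE.prems(2)] by simp
    qed
    then show ?case using der.ExE[OF ExE.hyps(1)] by simp
  qed simp_all
  then show ?thesis
    using assms(1-3) headed der.headed by (cases k) blast+
qed (use assms(3) in simp)

text \<open>Only \<open>EqE\<close> leads from neutral to properly headed derivations, and its
  conclusions are prime.\<close>

lemma headed_Bot:
  assumes "der Headed \<Gamma> (Fml Bot)"
  shows "der Neutral \<Gamma> (Fml Bot)"
  using assms
proof cases
  case (EqE t1 t2 x A)
  then show ?thesis by (cases A) auto
qed

lemma der_BotE:
  assumes "der k \<Gamma> C" "k = Normal" "C = Fml Bot" "prime_fm A" "closed_fm A"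
  shows "der Normal \<Gamma> (Fml A)"
  using assms
proof (induction rule: der.induct)
  case (normal \<Gamma> C)
  then show ?case by (auto intro: neutral_normal der.BotE headed_Bot)
next
  case (OrE \<Gamma> B1 B2 C)
  show ?case by (rule der.OrE[OF OrE.hyps(1)]) (use OrE in blast)+
next
  case (ExE \<Gamma> x B C)
  show ?case by (rule der.ExE[OF ExE.hyps(1)]) (use ExE in blast)
qed simp_all

text \<open>\<open>BotE\<close> does not conclude terms, but it concludes the prime formula
  \<open>t = t\<close>, from which \<open>AD\<close> extracts \<open>t\<close>.\<close>

lemma neutral_Bot_term:
  assumes "der Neutral \<Gamma> (Fml Bot)"
  shows "der Normal \<Gamma> (Trm t)"
  by (rule der.AD_refl, rule der.BotE[OF assms]) auto

text \<open>Since \<open>BotE\<close> has prime conclusions only, compound formulas are assembled by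
  introduction rules.\<close>

lemma neutral_Bot_fml:
  assumes "closed_fm A" "der Neutral \<Gamma> (Fml Bot)"
  shows "der Normal \<Gamma> (Fml A)"
  using assms
proof (induction A arbitrary: \<Gamma> rule: closed_fm_induct)
  case (prime A)
  then show ?case by (auto intro: der.intros)
next
  case (Imp A B)
  have "der Normal (insert (Fml A) \<Gamma>) (Fml B)"
    using Imp.IH(2) der_weaken[OF Imp.prems subset_insertI] by simp
  then show ?case using Imp.hyps(1) by (rule der.ImpI)
next
  case (Exi x A)
  show ?case by (rule der.ExI[OF Exi.IH[OF Exi.prems] neutral_Bot_term[OF Exi.prems]])
next
  case (Uni x A)
  show ?case by (intro der.UniI Uni.IH der_weaken[OF Uni.prems subset_insertI])
qed (auto intro: der.intros)

lemma neutral_Bot: "der Neutral \<Gamma> (Fml Bot) \<Longrightarrow> closed_node C \<Longrightarrow> der Normal \<Gamma> C"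
  by (cases C) (auto intro: neutral_Bot_fml neutral_Bot_term)

section \<open>Forcing\<close>

text \<open>Beth covers as well-founded trees that branch on neutral disjunctions and existential
  formulas and have their leaves in \<open>S\<close>. The clause \<open>bot\<close> is the empty
  cover of a world that neutrally derives falsum.\<close>

inductive_set cov :: "('c, 'p) node set set \<Rightarrow> ('c, 'p) node set set" for S where
  base: "\<Gamma> \<in> S \<Longrightarrow> \<Gamma> \<in> cov S"
| bot: "der Neutral \<Gamma> (Fml Bot) \<Longrightarrow> \<Gamma> \<in> cov S"
| disj: "der Neutral \<Gamma> (Fml (Or A B)) \<Longrightarrow> insert (Fml A) \<Gamma> \<in> cov S \<Longrightarrow>
    insert (Fml B) \<Gamma> \<in> cov S \<Longrightarrow> \<Gamma> \<in> cov S"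
| exi: "der Neutral \<Gamma> (Fml (Exi x A)) \<Longrightarrow>
    (\<And>a. insert (Fml (subst x (Par a) A)) (insert (Trm (Par a)) \<Gamma>) \<in> cov S) \<Longrightarrow> \<Gamma> \<in> cov S"

text \<open>The bind operation of the cover monad, combined with weakening: a cover is transported
  to a larger world and refined at its leaves. The last assumption speaks of all common extensions
  of a leaf and \<Gamma>', so that it survives when the induction adds assumptions to
  \<Gamma>'.\<close>

lemma cov_bind:
  assumes "\<Gamma> \<in> cov S" "\<Gamma> \<subseteq> \<Gamma>'"
    and "\<And>\<Delta> \<Delta>'. \<Delta> \<in> S \<Longrightarrow> \<Delta> \<subseteq> \<Delta>' \<Longrightarrow> \<Gamma>' \<subseteq> \<Delta>' \<Longrightarrow> \<Delta>' \<in> cov T"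
  shows "\<Gamma>' \<in> cov T"
  using assms
proof (induction arbitrary: \<Gamma>' rule: cov.induct)
  case (base \<Gamma>)
  show ?case by (rule base.prems(2)[OF base.hyps base.prems(1) subset_refl])
next
  case (bot \<Gamma>)
  show ?case by (rule cov.bot[OF der_weaken[OF bot.hyps bot.prems(1)]])
next
  case (disj \<Gamma> A B)
  have "insert (Fml A) \<Gamma>' \<in> cov T" "insert (Fml B) \<Gamma>' \<in> cov T"
    by (rule disj.IH, use disj.prems(1) in blast, rule disj.prems(2), assumption+, blast)+
  then show ?case by (rule cov.disj[OF der_weaken[OF disj.hyps(1) disj.prems(1)]])
next
  case (exi \<Gamma> x A)
  have "insert (Fml (subst x (Par a) A)) (insert (Trm (Par a)) \<Gamma>') \<in> cov T" for a
    by (rule exi.IH, use exi.prems(1) in blast, rule exi.prems(2), assumption+, blast)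
  then show ?case by (rule cov.exi[OF der_weaken[OF exi.hyps(1) exi.prems(1)]])
qed

lemma cov_subset_cov:
  assumes "\<Gamma> \<in> cov S" "S \<subseteq> cov T"
  shows "\<Gamma> \<in> cov T"
  using assms(1)
proof induction
  case (base \<Gamma>)
  then show ?case using assms(2) by (rule subsetD[rotated])
next
  case (bot \<Gamma>)
  then show ?case by (rule cov.bot)
next
  case (disj \<Gamma> A B)
  show ?case by (rule cov.disj[OF disj.hyps(1) disj.IH])
next
  case (exi \<Gamma> x A)
  show ?case by (rule cov.exi[OF exi.hyps(1) exi.IH])
qed

lemma cov_cov: "\<Gamma> \<in> cov (cov S) \<Longrightarrow> \<Gamma> \<in> cov S"
  by (erule cov_subset_cov) (rule subset_refl)

lemma cov_mono: "\<Gamma> \<in> cov S \<Longrightarrow> S \<subseteq> T \<Longrightarrow> \<Gamma> \<in> cov T"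
  by (erule cov_subset_cov) (auto intro: cov.base)

text \<open>Normal derivability is local: the branchings of a cover become applications of
  \<open>OrE\<close> and \<open>ExE\<close>, and an empty cover is handled by ex falso, for which
  \<open>C\<close> has to be closed.\<close>

lemma cov_normal:
  assumes "\<Gamma> \<in> cov S" "closed_node C" "\<And>\<Delta>. \<Delta> \<in> S \<Longrightarrow> der Normal \<Delta> C"
  shows "der Normal \<Gamma> C"
  using assms
proof (induction rule: cov.induct)
  case (bot \<Gamma>)
  then show ?case using neutral_Bot by blast
next
  case (disj \<Gamma> A B)
  then show ?case using der.OrE[OF disj.hyps(1)] by blast
next
  case (exi \<Gamma> x A)
  then show ?case using der.ExE[OF exi.hyps(1)] by blast
qed

text \<open>Quantifiers range over the terms that a world derives, since in negative free logic only
  these count as denoting there. Instances are not subformulas, so the recursion follows the number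
  of connectives.\<close>

function force :: "('c, 'p) fm \<Rightarrow> ('c, 'p) node set set" where
  "force (Pred R us) = {\<Gamma>. der Normal \<Gamma> (Fml (Pred R us))}"
| "force (Eq u v) = {\<Gamma>. der Normal \<Gamma> (Fml (Eq u v))}"
| "force Bot = {\<Gamma>. der Normal \<Gamma> (Fml Bot)}"
| "force (And A B) = force A \<inter> force B"
| "force (Or A B) = cov (force A \<union> force B)"
| "force (Imp A B) = {\<Gamma>. \<forall>\<Gamma>'. \<Gamma> \<subseteq> \<Gamma>' \<longrightarrow> \<Gamma>' \<in> force A \<longrightarrow> \<Gamma>' \<in> force B}"
| "force (Exi x A) = cov (\<Union>t. {\<Gamma>. der Normal \<Gamma> (Trm t)} \<inter> force (subst x t A))"
| "force (Uni x A) = {\<Gamma>. \<forall>\<Gamma>' t. \<Gamma> \<subseteq> \<Gamma>' \<longrightarrow> der Normal \<Gamma>' (Trm t) \<longrightarrow> \<Gamma>' \<in> force (subst x t A)}"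
  by pat_completeness auto
termination
  by (relation "measure connectives") auto

lemma force_ImpI:
  assumes "\<And>\<Gamma>'. \<Gamma> \<subseteq> \<Gamma>' \<Longrightarrow> \<Gamma>' \<in> force A \<Longrightarrow> \<Gamma>' \<in> force B"
  shows "\<Gamma> \<in> force (Imp A B)"
  unfolding force.simps by (intro CollectI allI impI assms)

lemma force_ImpD: "\<Gamma> \<in> force (Imp A B) \<Longrightarrow> \<Gamma> \<subseteq> \<Gamma>' \<Longrightarrow> \<Gamma>' \<in> force A \<Longrightarrow> \<Gamma>' \<in> force B"
  by simp

lemma force_UniI:
  assumes "\<And>\<Gamma>' t. \<Gamma> \<subseteq> \<Gamma>' \<Longrightarrow> der Normal \<Gamma>' (Trm t) \<Longrightarrow> \<Gamma>' \<in> force (subst x t A)"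
  shows "\<Gamma> \<in> force (Uni x A)"
  unfolding force.simps by (intro CollectI allI impI assms)

lemma force_UniD:
  "\<Gamma> \<in> force (Uni x A) \<Longrightarrow> \<Gamma> \<subseteq> \<Gamma>' \<Longrightarrow> der Normal \<Gamma>' (Trm t) \<Longrightarrow> \<Gamma>' \<in> force (subst x t A)"
  by simp

lemma force_OrI: "\<Gamma> \<in> force A \<or> \<Gamma> \<in> force B \<Longrightarrow> \<Gamma> \<in> force (Or A B)"
  by (auto intro: cov.base)

lemma force_ExiI: "\<Gamma> \<in> force (subst x t A) \<Longrightarrow> der Normal \<Gamma> (Trm t) \<Longrightarrow> \<Gamma> \<in> force (Exi x A)"
  unfolding force.simps by (rule cov.base) blast

primrec force_node :: "('c, 'p) node \<Rightarrow> ('c, 'p) node set set" where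
  "force_node (Fml A) = force A"
| "force_node (Trm t) = {\<Gamma>. der Normal \<Gamma> (Trm t)}"

lemma force_prime: "prime_fm A \<Longrightarrow> force A = {\<Gamma>. der Normal \<Gamma> (Fml A)}"
  by (cases A) auto

lemma force_mono: "\<Gamma> \<in> force A \<Longrightarrow> \<Gamma> \<subseteq> \<Gamma>' \<Longrightarrow> \<Gamma>' \<in> force A"
proof (induction A arbitrary: \<Gamma> \<Gamma>' rule: force.induct)
  case (4 A B)
  from 4(3) show ?case using 4(1,2)[OF _ 4(4)] by simp
next
  case (5 A B)
  from 5(3) have "\<Gamma> \<in> cov (force A \<union> force B)" by simp
  then have "\<Gamma>' \<in> cov (force A \<union> force B)"
    using 5(4)
  proof (rule cov_bind)
    fix \<Delta> \<Delta>' assume "\<Delta> \<in> force A \<union> force B" "\<Delta> \<subseteq> \<Delta>'"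
    then show "\<Delta>' \<in> cov (force A \<union> force B)"
      using 5(1,2)[OF _ \<open>\<Delta> \<subseteq> \<Delta>'\<close>] by (intro cov.base) blast
  qed
  then show ?case by simp
next
  case (6 A B)
  from 6(3) show ?case
    by (intro force_ImpI) (rule force_ImpD, assumption, rule subset_trans[OF 6(4)])
next
  case (7 x A)
  let ?S = "\<Union>t. {\<Gamma>. der Normal \<Gamma> (Trm t)} \<inter> force (subst x t A)"
  from 7(2) have "\<Gamma> \<in> cov ?S" by simp
  then have "\<Gamma>' \<in> cov ?S"
    using 7(3)
  proof (rule cov_bind)
    fix \<Delta> \<Delta>' assume "\<Delta> \<in> ?S" "\<Delta> \<subseteq> \<Delta>'"
    then obtain t where "der Normal \<Delta>' (Trm t)" "\<Delta>' \<in> force (subst x t A)"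
      using 7(1)[OF UNIV_I _ \<open>\<Delta> \<subseteq> \<Delta>'\<close>] der_weaken[OF _ \<open>\<Delta> \<subseteq> \<Delta>'\<close>] by blast
    then show "\<Delta>' \<in> cov ?S" by (intro cov.base) blast
  qed
  then show ?case by simp
next
  case (8 x A)
  from 8(2) show ?case
    by (intro force_UniI) (rule force_UniD, assumption, rule subset_trans[OF 8(3)])
next
  case (1 R us)
  then show ?case using der_weaken[of Normal \<Gamma> _ \<Gamma>'] by simp
next
  case (2 u v)
  then show ?case using der_weaken[of Normal \<Gamma> _ \<Gamma>'] by simp
next
  case 3
  then show ?case using der_weaken[of Normal \<Gamma> _ \<Gamma>'] by simp
qed

lemma force_node_mono: "\<Gamma> \<in> force_node C \<Longrightarrow> \<Gamma> \<subseteq> \<Gamma>' \<Longrightarrow> \<Gamma>' \<in> force_node C"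
  proof (cases C)
  case (Fml A)
  assume "\<Gamma> \<in> force_node C" "\<Gamma> \<subseteq> \<Gamma>'"
  then show ?thesis using force_mono[of \<Gamma> A \<Gamma>'] Fml by simp
next
  case (Trm t)
  assume "\<Gamma> \<in> force_node C" "\<Gamma> \<subseteq> \<Gamma>'"
  then show ?thesis using der_weaken[of Normal \<Gamma> C \<Gamma>'] Trm by simp
qed

text \<open>The sheaf condition: what is forced on a cover is forced outright. It lets
  \<open>OrE\<close> and \<open>ExE\<close> have conclusions of any form.\<close>

lemma cov_force: "closed_fm A \<Longrightarrow> \<Gamma> \<in> cov (force A) \<Longrightarrow> \<Gamma> \<in> force A"
proof (induction A arbitrary: \<Gamma> rule: closed_fm_induct)
  case (prime A)
  then show ?case
    using cov_normal[OF prime.prems, of "Fml A"] by (simp add: force_prime)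
next
  case Bot
  then show ?case
    using cov_normal[OF Bot, of "Fml Bot"] by simp
next
  case (And A B)
  then have "\<Gamma> \<in> cov (force A)" "\<Gamma> \<in> cov (force B)"
    by (auto elim: cov_mono)
  then show ?case using And.IH by simp
next
  case (Or A B)
  then show ?case by (simp add: cov_cov)
next
  case (Exi x A)
  then show ?case by (simp add: cov_cov)
next
  case (Imp A B)
  \<comment> \<open>The cover of \<Gamma> is pulled back to \<Gamma>'. By monotonicity
    \<open>A\<close> is still forced at its leaves, where the implication can be applied.\<close>
  have "\<Gamma>' \<in> cov (force B)" if "\<Gamma> \<subseteq> \<Gamma>'" "\<Gamma>' \<in> force A" for \<Gamma>'
    using Imp.prems that(1)
  proof (rule cov_bind)
    fix \<Delta> \<Delta>' assume "\<Delta> \<in> force (Imp A B)" "\<Delta> \<subseteq> \<Delta>'" "\<Gamma>' \<subseteq> \<Delta>'"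
    moreover have "\<Delta>' \<in> force A"
      using that(2) \<open>\<Gamma>' \<subseteq> \<Delta>'\<close> by (rule force_mono)
    ultimately show "\<Delta>' \<in> cov (force B)" by (auto intro: cov.base)
  qed
  then show ?case
    by (intro force_ImpI Imp.IH(2))
next
  case (Uni x A)
  have "\<Gamma>' \<in> cov (force (subst x t A))" if "\<Gamma> \<subseteq> \<Gamma>'" "der Normal \<Gamma>' (Trm t)" for \<Gamma>' t
    using Uni.prems that(1)
  proof (rule cov_bind)
    fix \<Delta> \<Delta>' assume "\<Delta> \<in> force (Uni x A)" "\<Delta> \<subseteq> \<Delta>'" "\<Gamma>' \<subseteq> \<Delta>'"
    moreover have "der Normal \<Delta>' (Trm t)"
      using that(2) \<open>\<Gamma>' \<subseteq> \<Delta>'\<close> by (rule der_weaken)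
    ultimately show "\<Delta>' \<in> cov (force (subst x t A))" by (auto intro: cov.base)
  qed
  then show ?case
    by (intro force_UniI Uni.IH)
qed

lemma cov_force_node: "closed_node C \<Longrightarrow> \<Gamma> \<in> cov (force_node C) \<Longrightarrow> \<Gamma> \<in> force_node C"
  by (cases C) (auto intro: cov_force cov_normal)

text \<open>The directions depend on each other: reflecting an implication needs its antecedent
  reified as the minor premise of \<open>ImpE\<close>, and reifying it needs its antecedent
  reflected as a new assumption.\<close>

lemma reflect_reify:
  assumes "closed_fm A"
  shows "(der Neutral \<Gamma> (Fml A) \<longrightarrow> \<Gamma> \<in> force A) \<and> (\<Gamma> \<in> force A \<longrightarrow> der Normal \<Gamma> (Fml A))"
  using assms
proof (induction A arbitrary: \<Gamma> rule: closed_fm_induct)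
  case (prime A)
  then show ?case by (simp add: force_prime neutral_normal)
next
  case Bot
  then show ?case by (simp add: neutral_normal)
next
  case (And A B)
  have "\<Gamma> \<in> force (And A B)" if "der Neutral \<Gamma> (Fml (And A B))"
    using der.AndE1[OF that] der.AndE2[OF that] And.IH by simp
  moreover have "der Normal \<Gamma> (Fml (And A B))" if "\<Gamma> \<in> force (And A B)"
    using that And.IH by (simp add: der.AndI)
  ultimately show ?case by blast
next
  case (Or A B)
  have "\<Gamma> \<in> force (Or A B)" if "der Neutral \<Gamma> (Fml (Or A B))"
  proof -
    have "insert (Fml A) \<Gamma> \<in> force A" "insert (Fml B) \<Gamma> \<in> force B"
      using Or by (simp_all add: hyp_fml)
    then show ?thesis using cov.disj[OF that] by (simp add: cov.base)
  qed
  moreover have "der Normal \<Gamma> (Fml (Or A B))" if "\<Gamma> \<in> force (Or A B)"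
    using that[unfolded force.simps]
  proof (rule cov_normal)
    fix \<Delta> assume "\<Delta> \<in> force A \<union> force B"
    then show "der Normal \<Delta> (Fml (Or A B))"
      using Or by (blast intro: der.OrI1 der.OrI2)
  qed (use Or in simp)
  ultimately show ?case by blast
next
  case (Imp A B)
  have "\<Gamma> \<in> force (Imp A B)" if neutral: "der Neutral \<Gamma> (Fml (Imp A B))"
  proof -
    have "\<Gamma>' \<in> force B" if "\<Gamma> \<subseteq> \<Gamma>'" "\<Gamma>' \<in> force A" for \<Gamma>'
      using der.ImpE[OF der_weaken[OF neutral that(1)]] Imp.IH that(2) by blast
    then show ?thesis by (rule force_ImpI)
  qed
  moreover have "der Normal \<Gamma> (Fml (Imp A B))" if "\<Gamma> \<in> force (Imp A B)"
  proof -
    have "insert (Fml A) \<Gamma> \<in> force A"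
      using Imp by (simp add: hyp_fml)
    then have "insert (Fml A) \<Gamma> \<in> force B"
      using force_ImpD[OF that] by blast
    then show ?thesis using Imp by (simp add: der.ImpI)
  qed
  ultimately show ?case by blast
next
  case (Exi x A)
  have "\<Gamma> \<in> force (Exi x A)" if neutral: "der Neutral \<Gamma> (Fml (Exi x A))"
  proof -
    have "insert (Fml (subst x (Par a) A)) (insert (Trm (Par a)) \<Gamma>) \<in> force (subst x (Par a) A)"
      for a using Exi by (simp add: hyp_fml)
    moreover have "der Normal (insert (Fml (subst x (Par a) A)) (insert (Trm (Par a)) \<Gamma>)) (Trm (Par a))"
      for a by (rule hyp_trm_normal) simp
    ultimately show ?thesis
      unfolding force.simps by (intro cov.exi[OF neutral] cov.base) blast
  qed
  moreover have "der Normal \<Gamma> (Fml (Exi x A))" if "\<Gamma> \<in> force (Exi x A)"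
    using that[unfolded force.simps]
  proof (rule cov_normal)
    fix \<Delta> assume "\<Delta> \<in> (\<Union>t. {\<Gamma>. der Normal \<Gamma> (Trm t)} \<inter> force (subst x t A))"
    then show "der Normal \<Delta> (Fml (Exi x A))"
      using Exi by (blast intro: der.ExI)
  \<comment> \<open>\<open>Par 0\<close> is an arbitrary choice: closedness of the existential
    formula can be read off from any instance.\<close>
  qed (use Exi closed_fm_Exi[of x A "Par 0"] in simp)
  ultimately show ?case by blast
next
  case (Uni x A)
  have "\<Gamma> \<in> force (Uni x A)" if neutral: "der Neutral \<Gamma> (Fml (Uni x A))"
  proof -
    have "\<Gamma>' \<in> force (subst x t A)" if "\<Gamma> \<subseteq> \<Gamma>'" "der Normal \<Gamma>' (Trm t)" for \<Gamma>' t
      using der.UniE[OF der_weaken[OF neutral that(1)] that(2)] Uni.IH by blast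
    then show ?thesis by (rule force_UniI)
  qed
  moreover have "der Normal \<Gamma> (Fml (Uni x A))" if "\<Gamma> \<in> force (Uni x A)"
  proof (rule der.UniI)
    \<comment> \<open>No freshness is asked of \<open>a\<close>: the added assumption alone puts
      \<open>Par a\<close> into the range of the quantifier.\<close>
    fix a
    have "insert (Trm (Par a)) \<Gamma> \<in> force (subst x (Par a) A)"
      using force_UniD[OF that] hyp_trm_normal by blast
    then show "der Normal (insert (Trm (Par a)) \<Gamma>) (Fml (subst x (Par a) A))"
      using Uni by blast
  qed
  ultimately show ?case by blast
qed

lemmas reflect = reflect_reify[THEN conjunct1, rule_format]
  and reify = reflect_reify[THEN conjunct2, rule_format]

lemma reify_node: "closed_node C \<Longrightarrow> \<Gamma> \<in> force_node C \<Longrightarrow> der Normal \<Gamma> C"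
  by (cases C) (auto intro: reify)

lemma reflect_hyp: "closed_node C \<Longrightarrow> C \<in> \<Gamma> \<Longrightarrow> \<Gamma> \<in> force_node C"
  by (cases C) (auto intro: hyp_trm_normal hyp_fml reflect)


section \<open>Soundness\<close>

lemma open_classes_simps:
  "open_classes (Inf r C []) = assumed r C"
  "open_classes (Inf r C [D]) = assumed r C \<union> (open_classes D - discharged r 0)"
  "open_classes (Inf r C [D, D1]) =
    assumed r C \<union> (open_classes D - discharged r 0) \<union> (open_classes D1 - discharged r 1)"
  "open_classes (Inf r C [D, D1, D2]) =
    assumed r C \<union> (open_classes D - discharged r 0) \<union> (open_classes D1 - discharged r 1) \<union>
    (open_classes D2 - discharged r 2)"
  by (auto simp: less_Suc_eq numeral_2_eq_2)

declare open_classes.simps [simp del] open_classes_simps [simp]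

text \<open>Forcing ignores labels. Pairing each forced node with every label turns the hypothesis
  of \<open>soundness\<close> into an inclusion between sets of classes.\<close>

definition forced_classes :: "(nat \<Rightarrow> 'c tm) \<Rightarrow> ('c, 'p) node set \<Rightarrow> (nat \<times> ('c, 'p) node) set" where
  "forced_classes \<sigma> \<Gamma> = {(u, C). \<Gamma> \<in> force_node (psub_node \<sigma> C)}"

lemma forced_classes_iff [simp]:
  "(u, C) \<in> forced_classes \<sigma> \<Gamma> \<longleftrightarrow> \<Gamma> \<in> force_node (psub_node \<sigma> C)"
  by (simp add: forced_classes_def)

lemma forced_classes_mono: "\<Gamma> \<subseteq> \<Gamma>' \<Longrightarrow> forced_classes \<sigma> \<Gamma> \<subseteq> forced_classes \<sigma> \<Gamma>'"
  by (rule subrelI) (simp, erule (1) force_node_mono)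

text \<open>World and environment vary in the induction: rules that discharge assumptions move to
  larger worlds, and rules with an eigenparameter change \<sigma>.\<close>

lemma soundness:
  assumes "deduction D" "open_classes D \<subseteq> forced_classes \<sigma> \<Gamma>"
  shows "\<Gamma> \<in> force_node (psub_node \<sigma> (concl D))"
  using assms
proof (induction arbitrary: \<sigma> \<Gamma> rule: deduction.induct)
  case (asm C u)
  then show ?case by simp
next
  case (and_I D1 D2 A B)
  have "\<Gamma> \<in> force (psub_fm \<sigma> A)" "\<Gamma> \<in> force (psub_fm \<sigma> B)"
    using and_I.IH[of \<sigma> \<Gamma>] and_I.hyps and_I.prems by simp_all
  then show ?case by simp
next
  case (and_E1 D A B)
  then have "\<Gamma> \<in> force_node (psub_node \<sigma> (concl D))" by simp
  then show ?case using and_E1.hyps by simp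
next
  case (and_E2 D A B)
  then have "\<Gamma> \<in> force_node (psub_node \<sigma> (concl D))" by simp
  then show ?case using and_E2.hyps by simp
next
  case (imp_I D B A u)
  have "\<Gamma>' \<in> force (psub_fm \<sigma> B)" if "\<Gamma> \<subseteq> \<Gamma>'" "\<Gamma>' \<in> force (psub_fm \<sigma> A)" for \<Gamma>'
  proof -
    have "open_classes D \<subseteq> insert (u, Fml A) (forced_classes \<sigma> \<Gamma>)"
      using imp_I.prems by auto
    then have "open_classes D \<subseteq> forced_classes \<sigma> \<Gamma>'"
      using forced_classes_mono[OF that(1), of \<sigma>] that(2) by auto
    from imp_I.IH[OF this] show ?thesis using imp_I.hyps by simp
  qed
  then have "\<Gamma> \<in> force (Imp (psub_fm \<sigma> A) (psub_fm \<sigma> B))" by (rule force_ImpI)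
  then show ?case by (simp del: force.simps)
next
  case (imp_E D1 D2 A B)
  have "\<Gamma> \<in> force (Imp (psub_fm \<sigma> A) (psub_fm \<sigma> B))" "\<Gamma> \<in> force (psub_fm \<sigma> A)"
    using imp_E.IH[of \<sigma> \<Gamma>] imp_E.hyps imp_E.prems by (simp_all del: force.simps)
  then have "\<Gamma> \<in> force (psub_fm \<sigma> B)" using force_ImpD[OF _ subset_refl] by blast
  then show ?case by simp
next
  case (or_I1 D A B)
  have "\<Gamma> \<in> force (psub_fm \<sigma> A)"
    using or_I1.IH[of \<sigma> \<Gamma>] or_I1.hyps or_I1.prems by simp
  then have "\<Gamma> \<in> force (Or (psub_fm \<sigma> A) (psub_fm \<sigma> B))" by (intro force_OrI disjI1)
  then show ?case by (simp del: force.simps)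
next
  case (or_I2 D B A)
  have "\<Gamma> \<in> force (psub_fm \<sigma> B)"
    using or_I2.IH[of \<sigma> \<Gamma>] or_I2.hyps or_I2.prems by simp
  then have "\<Gamma> \<in> force (Or (psub_fm \<sigma> A) (psub_fm \<sigma> B))" by (intro force_OrI disjI2)
  then show ?case by (simp del: force.simps)
next
  case (or_E D D1 D2 A B C u v)
  have closed: "closed_node (psub_node \<sigma> C)"
    using closed_concl[OF or_E.hyps(2)] or_E.hyps by simp
  have "\<Gamma> \<in> cov (force (psub_fm \<sigma> A) \<union> force (psub_fm \<sigma> B))"
    using or_E.IH(1)[of \<sigma> \<Gamma>] or_E.hyps or_E.prems by simp
  \<comment> \<open>At each leaf one disjunct is forced, so one of the minor premises can be
    evaluated there; \<open>cov_force_node\<close> then removes the cover.\<close>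
  then have "\<Gamma> \<in> cov (force_node (psub_node \<sigma> C))"
  proof (rule cov_bind[OF _ subset_refl])
    fix \<Delta> \<Delta>'
    assume \<Delta>: "\<Delta> \<in> force (psub_fm \<sigma> A) \<union> force (psub_fm \<sigma> B)" "\<Delta> \<subseteq> \<Delta>'" and sub: "\<Gamma> \<subseteq> \<Delta>'"
    have "open_classes D1 \<subseteq> insert (u, Fml A) (forced_classes \<sigma> \<Delta>')"
      and "open_classes D2 \<subseteq> insert (v, Fml B) (forced_classes \<sigma> \<Delta>')"
      using or_E.prems forced_classes_mono[OF sub, of \<sigma>] by auto
    moreover have "\<Delta>' \<in> force (psub_fm \<sigma> A) \<or> \<Delta>' \<in> force (psub_fm \<sigma> B)"
      using \<Delta> force_mono by blast
    ultimately have "open_classes D1 \<subseteq> forced_classes \<sigma> \<Delta>' \<or>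
        open_classes D2 \<subseteq> forced_classes \<sigma> \<Delta>'"
      by auto
    then have "\<Delta>' \<in> force_node (psub_node \<sigma> C)"
      using or_E.IH(2,3)[of \<sigma> \<Delta>'] by (auto simp: or_E.hyps)
    then show "\<Delta>' \<in> cov (force_node (psub_node \<sigma> C))" by (rule cov.base)
  qed
  then show ?case using cov_force_node[OF closed] by simp
next
  case (bot_E D B)
  have "der Normal \<Gamma> (Fml Bot)"
    using bot_E.IH[of \<sigma> \<Gamma>] bot_E.hyps bot_E.prems by simp
  moreover have "prime_fm (psub_fm \<sigma> B)" "closed_fm (psub_fm \<sigma> B)"
    using bot_E.hyps by (simp_all add: closed_fm_def)
  ultimately have "der Normal \<Gamma> (Fml (psub_fm \<sigma> B))"
    by (rule der_BotE[OF _ refl refl])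
  then show ?case using bot_E.hyps by (simp add: force_prime)
next
  case (uni_I D x a A u)
  have "\<Gamma>' \<in> force (subst x t (psub_fm \<sigma> A))" if "\<Gamma> \<subseteq> \<Gamma>'" "der Normal \<Gamma>' (Trm t)" for \<Gamma>' t
  proof -
    \<comment> \<open>By the eigenvariable condition, changing \<sigma> at \<open>a\<close> affects
      no open class except the discharged one, which is forced because \<Gamma>' derives
      \<open>t\<close>.\<close>
    have "open_classes D \<subseteq> forced_classes (\<sigma>(a := t)) \<Gamma>'"
    proof (rule subrelI)
      fix w C assume C: "(w, C) \<in> open_classes D"
      show "(w, C) \<in> forced_classes (\<sigma>(a := t)) \<Gamma>'"
      proof (cases "(w, C) = (u, Trm (Par a))")
        case False
        then have "(w, C) \<in> forced_classes \<sigma> \<Gamma>"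
          using uni_I.prems C by auto
        moreover have "a \<notin> params_node C" using uni_I.hyps C False by blast
        ultimately show ?thesis using force_node_mono[OF _ that(1)] by (simp add: psub_node_upd)
      qed (use that(2) in simp)
    qed
    then have "\<Gamma>' \<in> force_node (psub_node (\<sigma>(a := t)) (concl D))" by (rule uni_I.IH)
    then show ?thesis using uni_I.hyps by (simp add: psub_fm_eigen del: fun_upd_apply)
  qed
  then have "\<Gamma> \<in> force (Uni x (psub_fm \<sigma> A))" by (rule force_UniI)
  then show ?case by (simp del: force.simps)
next
  case (uni_E D1 D2 x A t)
  have "\<Gamma> \<in> force (Uni x (psub_fm \<sigma> A))" "der Normal \<Gamma> (Trm (psub_tm \<sigma> t))"
    using uni_E.IH[of \<sigma> \<Gamma>] uni_E.hyps uni_E.prems by (simp_all del: force.simps)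
  then have "\<Gamma> \<in> force (subst x (psub_tm \<sigma> t) (psub_fm \<sigma> A))"
    using force_UniD by blast
  then show ?case by (simp add: psub_fm_subst)
next
  case (ex_I D1 D2 x t A)
  have "\<Gamma> \<in> force (subst x (psub_tm \<sigma> t) (psub_fm \<sigma> A))" "der Normal \<Gamma> (Trm (psub_tm \<sigma> t))"
    using ex_I.IH[of \<sigma> \<Gamma>] ex_I.hyps ex_I.prems by (simp_all add: psub_fm_subst)
  then have "\<Gamma> \<in> force (Exi x (psub_fm \<sigma> A))" by (rule force_ExiI)
  then show ?case by (simp del: force.simps)
next
  case (ex_E D1 D2 x A C B a u v)
  have closed: "closed_node (psub_node \<sigma> C)"
    using closed_concl[OF ex_E.hyps(2)] ex_E.hyps by simp
  have "\<Gamma> \<in> cov (\<Union>t. {\<Gamma>. der Normal \<Gamma> (Trm t)} \<inter> force (subst x t (psub_fm \<sigma> A)))"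
    using ex_E.IH(1)[of \<sigma> \<Gamma>] ex_E.hyps ex_E.prems by simp
  then have "\<Gamma> \<in> cov (force_node (psub_node \<sigma> C))"
  proof (rule cov_bind[OF _ subset_refl])
    fix \<Delta> \<Delta>'
    assume "\<Delta> \<in> (\<Union>t. {\<Gamma>. der Normal \<Gamma> (Trm t)} \<inter> force (subst x t (psub_fm \<sigma> A)))"
      and sub: "\<Delta> \<subseteq> \<Delta>'" "\<Gamma> \<subseteq> \<Delta>'"
    then obtain t where t: "der Normal \<Delta>' (Trm t)" "\<Delta>' \<in> force (subst x t (psub_fm \<sigma> A))"
      using force_mono[OF _ sub(1)] der_weaken[OF _ sub(1)] by blast
    have B: "psub_fm (\<sigma>(a := t)) B = subst x t (psub_fm \<sigma> A)"
      using ex_E.hyps by (simp add: psub_fm_eigen)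
    have "open_classes D2 \<subseteq> forced_classes (\<sigma>(a := t)) \<Delta>'"
    proof (rule subrelI)
      fix w E assume E: "(w, E) \<in> open_classes D2"
      show "(w, E) \<in> forced_classes (\<sigma>(a := t)) \<Delta>'"
      proof (cases "(w, E) \<in> {(u, Fml B), (v, Trm (Par a))}")
        case True
        then show ?thesis using t B by auto
      next
        case False
        then have "(w, E) \<in> forced_classes \<sigma> \<Gamma>"
          using ex_E.prems E by auto
        moreover have "a \<notin> params_node E" using ex_E.hyps E False by blast
        ultimately show ?thesis using force_node_mono[OF _ sub(2)] by (simp add: psub_node_upd)
      qed
    qed
    then have "\<Delta>' \<in> force_node (psub_node (\<sigma>(a := t)) (concl D2))" by (rule ex_E.IH(2))
    \<comment> \<open>As \<open>a\<close> does not occur in \<open>C\<close>, the change of \<sigma>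
      disappears from the conclusion.\<close>
    then have "\<Delta>' \<in> force_node (psub_node \<sigma> C)"
      using ex_E.hyps by (simp add: psub_node_upd)
    then show "\<Delta>' \<in> cov (force_node (psub_node \<sigma> C))" by (rule cov.base)
  qed
  then show ?case using cov_force_node[OF closed] by simp
next
  case (eq_I D t)
  have "der Normal \<Gamma> (Trm (psub_tm \<sigma> t))"
    using eq_I.IH[of \<sigma> \<Gamma>] eq_I.hyps eq_I.prems by simp
  from der_EqI[OF this refl] show ?case by simp
next
  case (eq_E D1 D2 t1 t2 x A)
  have "der Normal \<Gamma> (Fml (Eq (Tm (psub_tm \<sigma> t1)) (Tm (psub_tm \<sigma> t2))))"
    "der Normal \<Gamma> (Fml (subst x (psub_tm \<sigma> t1) (psub_fm \<sigma> A)))"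
    using eq_E.IH[of \<sigma> \<Gamma>] eq_E.hyps eq_E.prems by (simp_all add: psub_fm_subst force_prime)
  then have "der Normal \<Gamma> (Fml (subst x (psub_tm \<sigma> t2) (psub_fm \<sigma> A)))"
    by (rule der_EqE[OF _ refl]) (use eq_E.hyps in simp)
  then show ?case using eq_E.hyps by (simp add: psub_fm_subst force_prime)
next
  case (AD_Pred D R us t)
  let ?A = "psub_fm \<sigma> (Pred R us)"
  have "der Normal \<Gamma> (Fml ?A)"
    using AD_Pred.IH[of \<sigma> \<Gamma>] AD_Pred.hyps AD_Pred.prems by simp
  moreover have "closed_fm ?A"
    using closed_concl[OF AD_Pred.hyps(1)] AD_Pred.hyps by (simp add: closed_fm_def)
  moreover have "psub_tm \<sigma> t \<in> terms_of ?A"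
    using AD_Pred.hyps by (intro terms_of_psub) simp
  ultimately have "der Normal \<Gamma> (Trm (psub_tm \<sigma> t))" by (rule der_AD[OF _ refl])
  then show ?case by simp
next
  case (AD_Eq D t1 t2 t)
  let ?A = "psub_fm \<sigma> (Eq (Tm t1) (Tm t2))"
  have "der Normal \<Gamma> (Fml ?A)"
    using AD_Eq.IH[of \<sigma> \<Gamma>] AD_Eq.hyps AD_Eq.prems by simp
  moreover have "closed_fm ?A" by simp
  moreover have "psub_tm \<sigma> t \<in> terms_of ?A"
    using AD_Eq.hyps by (intro terms_of_psub) auto
  ultimately have "der Normal \<Gamma> (Trm (psub_tm \<sigma> t))" by (rule der_AD[OF _ refl])
  then show ?case by simp
qed

section \<open>From deductions to normal derivations\<close>

lemma closed_open_classes: "deduction D \<Longrightarrow> \<forall>(u, C)\<in>open_classes D. closed_node C"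
proof (induction rule: deduction.induct)
  case (uni_I D x a A u)
  from uni_I.IH show ?case by auto
next
  case (ex_E D1 D2 x A C B a u v)
  from ex_E.IH show ?case by auto
qed auto

text \<open>Finiteness guarantees that fresh eigenparameters remain when a tree is built.\<close>

lemma finite_open_classes: "finite (open_classes D)"
proof (induction D)
  case (Inf r C Ds)
  have "finite (assumed r C)" by (cases r) auto
  then show ?case using Inf by (auto simp: open_classes.simps)
qed

lemma deduction_imp_der:
  assumes "deduction D"
  shows "der Normal (open_assumptions D) (concl D)"
proof -
  \<comment> \<open>Under the identity environment \<open>Par\<close>, reflection forces each open
    assumption at the world that consists of them all.\<close>
  have "open_classes D \<subseteq> forced_classes Par (open_assumptions D)"
  proof (rule subrelI)
    fix u C assume "(u, C) \<in> open_classes D"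
    then show "(u, C) \<in> forced_classes Par (open_assumptions D)"
      using closed_open_classes[OF assms] reflect_hyp[of C "open_assumptions D"]
      by (force simp: open_assumptions_def)
  qed
  from soundness[OF assms this]
  have "open_assumptions D \<in> force_node (concl D)" by simp
  then show ?thesis by (rule reify_node[OF closed_concl[OF assms]])
qed

section \<open>Normal deduction trees\<close>

text \<open>
  A longer segment ends with an occurrence concluded by \<open>OrE\<close> or \<open>ExE\<close>. Forbidding these
  rules just above an elimination, \<open>AD\<close> or \<open>EqI\<close> makes normality a condition on adjacent
  rule applications.
\<close>

definition detour_free :: "('c, 'p) ded \<Rightarrow> bool" where
  "detour_free D \<longleftrightarrow>
     (is_elim (rule_of D) \<longrightarrow> prems D \<noteq> [] \<longrightarrow>
        \<not> is_intro (rule_of (prems D ! 0)) \<and> \<not> is_OrE_ExE (rule_of (prems D ! 0))) \<and>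
     (rule_of D = AD \<longrightarrow> (\<forall>E\<in>set (prems D).
        \<not> is_OrE_ExE (rule_of E) \<and> rule_of E \<noteq> EqI \<and> rule_of E \<noteq> EqE)) \<and>
     (rule_of D = EqI \<longrightarrow> (\<forall>E\<in>set (prems D).
        \<not> is_OrE_ExE (rule_of E) \<and>
        \<not> (rule_of E = AD \<and> (\<exists>t. concl E = Trm t \<and> concl (prems E ! 0) = Fml (Eq (Tm t) (Tm t))))))"

definition hereditarily_detour_free :: "('c, 'p) ded \<Rightarrow> bool" where
  "hereditarily_detour_free D \<longleftrightarrow> (\<forall>p. occurs D p \<longrightarrow> detour_free (subded D p))"

lemma hereditarily_detour_free_Inf:
  "hereditarily_detour_free (Inf r C Ds) \<longleftrightarrow>
     detour_free (Inf r C Ds) \<and> (\<forall>D\<in>set Ds. hereditarily_detour_free D)"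
  (is "?L \<longleftrightarrow> ?R")
proof
  assume L: ?L
  have "hereditarily_detour_free D" if "D \<in> set Ds" for D
  proof -
    from that obtain i where "i < length Ds" "D = Ds ! i" by (auto simp: in_set_conv_nth)
    then show ?thesis
      using L[unfolded hereditarily_detour_free_def, rule_format, of "i # _"]
      by (simp add: hereditarily_detour_free_def)
  qed
  then show ?R using L[unfolded hereditarily_detour_free_def, rule_format, of "[]"] by simp
next
  assume R: ?R
  show ?L unfolding hereditarily_detour_free_def
  proof (intro allI impI)
    fix p assume "occurs (Inf r C Ds) p"
    then show "detour_free (subded (Inf r C Ds) p)"
      using R by (cases p) (auto simp: hereditarily_detour_free_def)
  qed
qed

section \<open>Segments and adjacent rule applications\<close>

lemma occurs_snoc: "occurs D (q @ [i]) \<longleftrightarrow> occurs D q \<and> i < length (prems (subded D q))"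
  by (induction q arbitrary: D) auto

lemma subded_snoc: "subded D (q @ [i]) = prems (subded D q) ! i"
  by (induction q arbitrary: D) auto

lemma segment_cases:
  assumes "segment D C ps"
  obtains p where "ps = [p]" | "length ps > 1" "is_OrE_ExE (rule_at D (last ps))"
proof -
  have "ps \<noteq> []" using assms by (simp add: segment_def)
  \<comment> \<open>The last two occurrences suffice: the path of the final one is that of its
    predecessor without the last index, so it is concluded by the rule whose minor premise the
    predecessor is.\<close>
  then consider p where "ps = [p]" | qs p q where "ps = qs @ [p, q]"
    by (metis append_Cons append_Nil append_assoc rev_exhaust)
  then show thesis
  proof cases
    case (2 qs p q)
    then have "Suc (length qs) < length ps" "ps ! length qs = p" "ps ! Suc (length qs) = q"
      by (auto simp: nth_append)
    then have "minor_premise_of is_OrE_ExE D p" "q = butlast p"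
      using assms by (auto simp: segment_def)
    then have "is_OrE_ExE (rule_at D q)" by (auto simp: minor_premise_of_def)
    then show thesis using that(2) 2 by simp
  qed (rule that(1))
qed

lemma segment_last_occurs: "segment D C ps \<Longrightarrow> occurs D (last ps) \<and> node_at D (last ps) = C"
  by (simp add: segment_def)

lemma hereditarily_detour_free_premise:
  assumes "hereditarily_detour_free D" "occurs D (q @ [i])"
  shows "detour_free (subded D q)" "subded D (q @ [i]) \<in> set (prems (subded D q))"
    "prems (subded D q) \<noteq> []"
  using assms by (auto simp: hereditarily_detour_free_def occurs_snoc subded_snoc)

lemma normal_form_if_detour_free:
  assumes "hereditarily_detour_free D"
  shows "normal_form D"
proof -
  have "\<not> maximal_elim D ps" for ps
  proof
    assume max: "maximal_elim D ps"
    then obtain A q where seg: "segment D (Fml A) ps" and q: "last ps = q @ [0]" "is_elim (rule_at D q)"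
      by (auto simp: maximal_elim_def major_premise_of_def)
    have free: "\<not> is_intro (rule_at D (last ps))" "\<not> is_OrE_ExE (rule_at D (last ps))"
      using hereditarily_detour_free_premise[OF assms, of q 0] segment_last_occurs[OF seg] q
      by (auto simp: detour_free_def subded_snoc)
    from seg show False
      by (cases rule: segment_cases) (use free max in \<open>auto simp: maximal_elim_def\<close>)
  qed
  moreover have AD: "\<not> is_OrE_ExE (rule_at D p) \<and> rule_at D p \<noteq> EqI \<and> rule_at D p \<noteq> EqE"
    if "premise_of (\<lambda>r. r = AD) D p" "occurs D p" for p
    using that hereditarily_detour_free_premise[OF assms]
    by (fastforce simp: premise_of_def detour_free_def)
  moreover have "\<not> maximal_EqI_AD D ps" for ps
  proof
    assume max: "maximal_EqI_AD D ps"
    then obtain t where seg: "segment D (Fml (Eq (Tm t) (Tm t))) ps"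
      by (auto simp: maximal_EqI_AD_def)
    have "\<not> is_OrE_ExE (rule_at D (last ps)) \<and> rule_at D (last ps) \<noteq> EqI"
      using AD[of "last ps"] max segment_last_occurs[OF seg] by (auto simp: maximal_EqI_AD_def)
    with seg show False
      by (cases rule: segment_cases) (use max in \<open>auto simp: maximal_EqI_AD_def\<close>)
  qed
  moreover have "\<not> maximal_AD_EqI D ps" for ps
  proof
    assume max: "maximal_AD_EqI D ps"
    then obtain t q i where seg: "segment D (Trm t) ps"
      and ad: "rule_at D (hd ps) = AD" "node_at D (hd ps @ [0]) = Fml (Eq (Tm t) (Tm t))"
      and q: "last ps = q @ [i]" "rule_at D q = EqI"
      by (auto simp: maximal_AD_EqI_def premise_of_def)
    have "\<not> is_OrE_ExE (rule_at D (last ps)) \<and> \<not> (rule_at D (last ps) = AD \<and>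
        node_at D (last ps) = Trm t \<and> node_at D (last ps @ [0]) = Fml (Eq (Tm t) (Tm t)))"
      using hereditarily_detour_free_premise[OF assms, of q i] segment_last_occurs[OF seg] q
      by (simp add: detour_free_def subded_snoc[of D "q @ [i]"] del: append_assoc)
    with seg show False
      by (cases rule: segment_cases) (use ad segment_last_occurs[OF seg] in auto)
  qed
  moreover have "\<not> maximal_EqE_AD D ss" for ss
  proof
    assume max: "maximal_EqE_AD D ss"
    then obtain A where seg: "segment D (Fml A) (last ss)"
      unfolding maximal_EqE_AD_def EqE_segment_def by (meson last_in_set)
    \<comment> \<open>The last segment is concluded by \<open>EqE\<close>. If its length is 1,
      \<open>EqE\<close> stands directly above \<open>AD\<close>; otherwise \<open>OrE\<close> or
      \<open>ExE\<close> does.\<close>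
    have "\<not> is_OrE_ExE (rule_at D (last (last ss))) \<and> rule_at D (last (last ss)) \<noteq> EqE"
      using AD[of "last (last ss)"] max segment_last_occurs[OF seg] by (auto simp: maximal_EqE_AD_def)
    with seg show False
      by (cases rule: segment_cases)
        (use max in \<open>auto simp: maximal_EqE_AD_def EqE_segment_def concl_of_EqE_def\<close>)
  qed
  ultimately show ?thesis by (simp add: normal_form_def)
qed


text \<open>What each kind promises about the last rule of a tree, so that no detour arises when the
  tree becomes a premise. \<open>Normal\<close> promises nothing, which is enough for minor premises
  and for introductions other than \<open>EqI\<close>.\<close>

primrec root_of_kind :: "kind \<Rightarrow> ('c, 'p) ded \<Rightarrow> bool" where
  "root_of_kind Neutral D \<longleftrightarrow>
     \<not> is_intro (rule_of D) \<and> \<not> is_OrE_ExE (rule_of D) \<and> rule_of D \<noteq> EqE \<and>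
     \<not> (rule_of D = AD \<and> (\<exists>t. concl D = Trm t \<and> concl (prems D ! 0) = Fml (Eq (Tm t) (Tm t))))"
| "root_of_kind Headed D \<longleftrightarrow> \<not> is_intro (rule_of D) \<and> \<not> is_OrE_ExE (rule_of D)"
| "root_of_kind Normal D \<longleftrightarrow> True"

text \<open>
  All assumptions are labelled \<open>0\<close>, so that a discharging rule removes all
  assumptions of the formula or term in question.
\<close>

definition realizes :: "kind \<Rightarrow> ('c, 'p) node set \<Rightarrow> ('c, 'p) node \<Rightarrow> ('c, 'p) ded \<Rightarrow> bool" where
  "realizes k \<Gamma> C D \<longleftrightarrow> deduction D \<and> concl D = C \<and> open_classes D \<subseteq> {0} \<times> \<Gamma> \<and>
     hereditarily_detour_free D \<and> root_of_kind k D"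

text \<open>Closedness excludes bound variables from an identity, as \<open>AD_Eq\<close>
  requires.\<close>

lemma deduction_AD:
  assumes "deduction D" "concl D = Fml A" "closed_fm A" "t \<in> terms_of A"
  shows "deduction (Inf AD (Trm t) [D])"
proof (cases A)
  case (Eq u v)
  then obtain t1 t2 where "u = Tm t1" "v = Tm t2"
    using assms(3) by (cases u; cases v) (auto simp: closed_fm_def)
  then show ?thesis using assms Eq by (auto intro: deduction.AD_Eq)
qed (use assms in \<open>auto intro: deduction.AD_Pred\<close>)

lemma der_imp_realizes: "der k \<Gamma> C \<Longrightarrow> finite \<Gamma> \<Longrightarrow> \<exists>D. realizes k \<Gamma> C D"
proof (induction rule: der.induct)
  case (hyp C \<Gamma>)
  then have "realizes Neutral \<Gamma> C (Inf (Asm 0) C [])"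
    by (simp add: realizes_def hereditarily_detour_free_Inf detour_free_def deduction.asm)
  then show ?case ..
next
  case (AndE1 \<Gamma> A B)
  then obtain D where "realizes Neutral \<Gamma> (Fml (And A B)) D" by blast
  then have "realizes Neutral \<Gamma> (Fml A) (Inf AndE (Fml A) [D])"
    by (auto simp: realizes_def hereditarily_detour_free_Inf detour_free_def intro: deduction.and_E1)
  then show ?case ..
next
  case (AndE2 \<Gamma> A B)
  then obtain D where "realizes Neutral \<Gamma> (Fml (And A B)) D" by blast
  then have "realizes Neutral \<Gamma> (Fml B) (Inf AndE (Fml B) [D])"
    by (auto simp: realizes_def hereditarily_detour_free_Inf detour_free_def intro: deduction.and_E2)
  then show ?case ..
next
  case (ImpE \<Gamma> A B)
  then obtain D D1 where "realizes Neutral \<Gamma> (Fml (Imp A B)) D" "realizes Normal \<Gamma> (Fml A) D1"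
    by blast
  then have "realizes Neutral \<Gamma> (Fml B) (Inf ImpE (Fml B) [D, D1])"
    by (auto simp: realizes_def hereditarily_detour_free_Inf detour_free_def intro: deduction.imp_E)
  then show ?case ..
next
  case (UniE \<Gamma> x A t)
  then obtain D D1 where "realizes Neutral \<Gamma> (Fml (Uni x A)) D" "realizes Normal \<Gamma> (Trm t) D1"
    by blast
  then have "realizes Neutral \<Gamma> (Fml (subst x t A)) (Inf UniE (Fml (subst x t A)) [D, D1])"
    by (auto simp: realizes_def hereditarily_detour_free_Inf detour_free_def intro: deduction.uni_E)
  then show ?case ..
next
  case (BotE \<Gamma> A)
  then obtain D where "realizes Neutral \<Gamma> (Fml Bot) D" by blast
  then have "realizes Neutral \<Gamma> (Fml A) (Inf BotE (Fml A) [D])"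
    using BotE.hyps
    by (auto simp: realizes_def hereditarily_detour_free_Inf detour_free_def intro: deduction.bot_E)
  then show ?case ..
next
  case (AD \<Gamma> A t)
  then obtain D where "realizes Neutral \<Gamma> (Fml A) D" by blast
  then have "realizes Neutral \<Gamma> (Trm t) (Inf AD (Trm t) [D])"
    using AD.hyps
    by (auto simp: realizes_def hereditarily_detour_free_Inf detour_free_def intro: deduction_AD)
  then show ?case ..
next
  case (headed \<Gamma> C)
  then show ?case by (auto simp: realizes_def)
next
  case (EqE \<Gamma> t1 t2 x A)
  then obtain D D1 where "realizes Headed \<Gamma> (Fml (Eq (Tm t1) (Tm t2))) D"
    "realizes Normal \<Gamma> (Fml (subst x t1 A)) D1" by blast
  then have "realizes Headed \<Gamma> (Fml (subst x t2 A)) (Inf EqE (Fml (subst x t2 A)) [D, D1])"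
    using EqE.hyps
    by (auto simp: realizes_def hereditarily_detour_free_Inf detour_free_def intro: deduction.eq_E)
  then show ?case ..
next
  case (normal \<Gamma> C)
  then show ?case by (auto simp: realizes_def)
next
  case (AD_refl \<Gamma> t)
  then obtain D where "realizes Neutral \<Gamma> (Fml (Eq (Tm t) (Tm t))) D" by blast
  then have "realizes Normal \<Gamma> (Trm t) (Inf AD (Trm t) [D])"
    by (auto simp: realizes_def hereditarily_detour_free_Inf detour_free_def intro: deduction.AD_Eq)
  then show ?case ..
next
  case (EqI \<Gamma> t)
  then obtain D where "realizes Neutral \<Gamma> (Trm t) D" by blast
  then have "realizes Normal \<Gamma> (Fml (Eq (Tm t) (Tm t))) (Inf EqI (Fml (Eq (Tm t) (Tm t))) [D])"
    by (auto simp: realizes_def hereditarily_detour_free_Inf detour_free_def intro: deduction.eq_I)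
  then show ?case ..
next
  case (AndI \<Gamma> A B)
  then obtain D D1 where "realizes Normal \<Gamma> (Fml A) D" "realizes Normal \<Gamma> (Fml B) D1" by blast
  then have "realizes Normal \<Gamma> (Fml (And A B)) (Inf AndI (Fml (And A B)) [D, D1])"
    by (auto simp: realizes_def hereditarily_detour_free_Inf detour_free_def intro: deduction.and_I)
  then show ?case ..
next
  case (ImpI A \<Gamma> B)
  then obtain D where "realizes Normal (insert (Fml A) \<Gamma>) (Fml B) D" by auto
  \<comment> \<open>If \<open>A\<close> also belongs to \<Gamma>, its assumptions are discharged all
    the same; this only shrinks the set of open classes, for which \<open>realizes\<close> asks an
    inclusion.\<close>
  then have "realizes Normal \<Gamma> (Fml (Imp A B)) (Inf (ImpI 0 A) (Fml (Imp A B)) [D])"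
    using ImpI.hyps
    by (auto simp: realizes_def hereditarily_detour_free_Inf detour_free_def intro: deduction.imp_I)
  then show ?case ..
next
  case (OrI1 \<Gamma> A B)
  then obtain D where "realizes Normal \<Gamma> (Fml A) D" by blast
  then have "realizes Normal \<Gamma> (Fml (Or A B)) (Inf OrI (Fml (Or A B)) [D])"
    using OrI1.hyps
    by (auto simp: realizes_def hereditarily_detour_free_Inf detour_free_def intro: deduction.or_I1)
  then show ?case ..
next
  case (OrI2 \<Gamma> B A)
  then obtain D where "realizes Normal \<Gamma> (Fml B) D" by blast
  then have "realizes Normal \<Gamma> (Fml (Or A B)) (Inf OrI (Fml (Or A B)) [D])"
    using OrI2.hyps
    by (auto simp: realizes_def hereditarily_detour_free_Inf detour_free_def intro: deduction.or_I2)
  then show ?case ..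
next
  case (OrE \<Gamma> A B C)
  then obtain D D1 D2 where "realizes Neutral \<Gamma> (Fml (Or A B)) D"
    "realizes Normal (insert (Fml A) \<Gamma>) C D1" "realizes Normal (insert (Fml B) \<Gamma>) C D2" by auto
  then have "realizes Normal \<Gamma> C (Inf (OrE 0 A 0 B) C [D, D1, D2])"
    by (auto simp: realizes_def hereditarily_detour_free_Inf detour_free_def intro: deduction.or_E)
  then show ?case ..
next
  case (UniI \<Gamma> x A)
  have "finite (insert (Fml (Uni x A)) \<Gamma>)" using UniI.prems by simp
  \<comment> \<open>Among the derivations given for all parameters, the one for a parameter foreign
    to \<Gamma> and to the conclusion is turned into a tree.\<close>
  then obtain a where fresh: "\<forall>C\<in>insert (Fml (Uni x A)) \<Gamma>. a \<notin> params_node C"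
    using exists_fresh_parameter by blast
  obtain D where D: "realizes Normal (insert (Trm (Par a)) \<Gamma>) (Fml (subst x (Par a) A)) D"
    using UniI.IH[of a] UniI.prems by auto
  then have "deduction (Inf (UniI 0 a) (Fml (Uni x A)) [D])"
    using fresh by (intro deduction.uni_I) (auto simp: realizes_def)
  then have "realizes Normal \<Gamma> (Fml (Uni x A)) (Inf (UniI 0 a) (Fml (Uni x A)) [D])"
    using D by (auto simp: realizes_def hereditarily_detour_free_Inf detour_free_def)
  then show ?case ..
next
  case (ExI \<Gamma> x t A)
  then obtain D D1 where "realizes Normal \<Gamma> (Fml (subst x t A)) D" "realizes Normal \<Gamma> (Trm t) D1"
    by blast
  then have "realizes Normal \<Gamma> (Fml (Exi x A)) (Inf ExI (Fml (Exi x A)) [D, D1])"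
    by (auto simp: realizes_def hereditarily_detour_free_Inf detour_free_def intro: deduction.ex_I)
  then show ?case ..
next
  case (ExE \<Gamma> x A C)
  \<comment> \<open>\<open>C\<close> is included because the eigenparameter of \<open>ExE\<close>
    must not occur in the conclusion.\<close>
  have "finite (insert (Fml (Exi x A)) (insert C \<Gamma>))" using ExE.prems by simp
  then obtain a where fresh:
    "\<forall>E\<in>insert (Fml (Exi x A)) (insert C \<Gamma>). a \<notin> params_node E"
    using exists_fresh_parameter by blast
  let ?B = "subst x (Par a) A"
  obtain D where D: "realizes Neutral \<Gamma> (Fml (Exi x A)) D"
    using ExE.IH(1) ExE.prems by blast
  obtain D1 where D1: "realizes Normal (insert (Fml ?B) (insert (Trm (Par a)) \<Gamma>)) C D1"
    using ExE.IH(2)[of a] ExE.prems by auto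
  have "deduction (Inf (ExE 0 ?B 0 a) C [D, D1])"
    using D D1 fresh by (intro deduction.ex_E[of _ _ x A]) (auto simp: realizes_def)
  then have "realizes Normal \<Gamma> C (Inf (ExE 0 ?B 0 a) C [D, D1])"
    using D D1 by (auto simp: realizes_def hereditarily_detour_free_Inf detour_free_def)
  then show ?case ..
qed

theorem theorem2:
  fixes D :: "('c, 'p) ded" and A :: "('c, 'p) node" and \<Gamma> :: "('c, 'p) node set"
  assumes "deduction D" and "concl D = A" and "open_assumptions D = \<Gamma>"
  shows "\<exists>D' :: ('c, 'p) ded.
           deduction D' \<and> concl D' = A \<and> open_assumptions D' \<subseteq> \<Gamma> \<and> normal_form D'"
proof -
  have "finite \<Gamma>"
    using assms(3) finite_open_classes[of D] by (auto simp: open_assumptions_def)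
  then obtain D' where D': "realizes Normal \<Gamma> A D'"
    using der_imp_realizes deduction_imp_der[OF assms(1)] assms(2,3) by blast
  then have "open_assumptions D' \<subseteq> \<Gamma>"
    by (auto simp: realizes_def open_assumptions_def)
  then show ?thesis
    using D' normal_form_if_detour_free by (auto simp: realizes_def)
qed

end
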